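(* Let $e\ge 2$ be an integer, $p$ a prime and $r\ge 1$ an integer with $p^r\equiv 1 \pmod e$. Fix a generator $\gamma$ of $\mathbb{F}_{p^r}^\times$, let $n\ge 1$ be an integer, and fix a generator $\lambda$ of $\mathbb{F}_{p^{nr}}^\times$ such that $\mathrm{Nr}(\lambda)\gamma^{-1}$ is an $e$-th power in $\mathbb{F}_{p^r}^\times$, where $\mathrm{Nr}:\mathbb{F}_{p^{nr}}\to\mathbb{F}_{p^r}$ is the norm. Let $C_r$ be the multiplication matrix of the Gaussian periods of degree $e$ for $\mathbb{F}_{p^r}$ with respect to $\gamma$, and $C_{nr}$ that for $\mathbb{F}_{p^{nr}}$ with respect to $\lambda$. Then \[ C_{nr}=(-1)^{n-1}C_r^{(n)}, \] where $C_r^{(n)}=C_r\overset{-1}{\ast}\cdots\overset{-1}{\ast}C_r$ ($n$ factors). In particular $P_{e,nr}(X)=\mathrm{Char}_X\big((-1)^{n-1}C_r^{(n)}\big)$, where $P_{e,nr}(X)=\prod_{i=0}^{e-1}(X-\eta_{nr}(i))$ and $\mathrm{Char}_X$ denotes the characteristic polynomial.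
   Context: For a prime power $q=p^m$ with $q\equiv1\pmod e$, write $q=ef+1$, let $\zeta_p=e^{2\pi i/p}$, $\mathrm{Tr}:\mathbb{F}_q\to\mathbb{F}_p$ the trace, and $\beta$ a generator of $\mathbb{F}_q^\times$. Gaussian periods: $\eta(i)=\sum_{j=0}^{f-1}\zeta_p^{\mathrm{Tr}(\beta^{ej+i})}$, $i\in\mathbb{Z}/e\mathbb{Z}$. Cyclotomic numbers: for $0\le i,j\le e-1$, $\mathrm{Cyc}(i,j)=\#\{(v_1,v_2):0\le v_1,v_2\le f-1,\ 1+\beta^{ev_1+i}=\beta^{ev_2+j}\text{ in }\mathbb{F}_q\}$. Let $D_i=1$ if $-1\in\beta^{i}(\mathbb{F}_q^\times)^e$ and $D_i=0$ otherwise. The multiplication matrix is the $e\times e$ matrix $C=[\mathrm{Cyc}(i,j)-D_if]_{0\le i,j\le e-1}$ (it satisfies $\eta(m)\eta(m+i)=\sum_j(\mathrm{Cyc}(i,j)-D_if)\eta(m+j)$). For $e\times e$ matrices $A=[a_{i,j}]$, $B=[b_{i,j}]$ (indices in $\mathbb{Z}/e\mathbb{Z}$) and $d\in(\mathbb{Z}/e\mathbb{Z})\setminus\{0\}$, the $d$-composition is $A\overset{d}{\ast}B=\big[\sum_{s=0}^{e-1}\sum_{t=0}^{e-1}a_{s,t}b_{ds+i,dt+j}\big]_{0\le i,j\le e-1}$; the $(-1)$-composition is associative, so the $n$-fold product is well defined. *)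

theory Defs
  imports Complex_Main "Jordan_Normal_Form.Char_Poly"
begin

text \<open>All fields of characteristic p considered here are realised inside one ambient
finite field K with |K| = p^(n r).  For m dividing n r, the field F_(p^m) is the unique
subfield of K of order p^m, namely the set of roots of X^(p^m) - X.\<close>

definition subfield_pm :: "nat \<Rightarrow> nat \<Rightarrow> 'K::{finite,field} set" where
  "subfield_pm p m = {x. x ^ (p ^ m) = x}"

definition is_generator :: "nat \<Rightarrow> nat \<Rightarrow> 'K::{finite,field} \<Rightarrow> bool" where
  "is_generator p m \<beta> \<longleftrightarrow> \<beta> \<in> subfield_pm p m \<and> range (\<lambda>k::nat. \<beta> ^ k) = subfield_pm p m - {0}"

definition trace_pm :: "nat \<Rightarrow> nat \<Rightarrow> 'K::{finite,field} \<Rightarrow> 'K" where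
  "trace_pm p m x = (\<Sum>k<m. x ^ (p ^ k))"

text \<open>Norm F_(p^(n r)) -> F_(p^r) (product of the Galois conjugates).\<close>
definition norm_rel :: "nat \<Rightarrow> nat \<Rightarrow> nat \<Rightarrow> 'K::{finite,field} \<Rightarrow> 'K" where
  "norm_rel p r n x = (\<Prod>k<n. x ^ (p ^ (r * k)))"

definition to_Zp :: "nat \<Rightarrow> 'K::{finite,field} \<Rightarrow> nat" where
  "to_Zp p y = (THE j. j < p \<and> of_nat j = y)"

definition f_of :: "nat \<Rightarrow> nat \<Rightarrow> nat \<Rightarrow> nat" where
  "f_of p m e = (p ^ m - 1) div e"

definition gauss_period :: "nat \<Rightarrow> nat \<Rightarrow> nat \<Rightarrow> 'K::{finite,field} \<Rightarrow> nat \<Rightarrow> complex" where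
  "gauss_period p m e \<beta> i =
     (\<Sum>j<f_of p m e. cis (2 * pi * real (to_Zp p (trace_pm p m (\<beta> ^ (e * j + i)))) / real p))"

definition period_poly :: "nat \<Rightarrow> nat \<Rightarrow> nat \<Rightarrow> 'K::{finite,field} \<Rightarrow> complex poly" where
  "period_poly p m e \<beta> = (\<Prod>i<e. [:- gauss_period p m e \<beta> i, 1:])"

definition cyc_num :: "nat \<Rightarrow> nat \<Rightarrow> nat \<Rightarrow> 'K::{finite,field} \<Rightarrow> nat \<Rightarrow> nat \<Rightarrow> nat" where
  "cyc_num p m e \<beta> i j = card {(v1, v2). v1 < f_of p m e \<and> v2 < f_of p m e \<and>
       1 + \<beta> ^ (e * v1 + i) = \<beta> ^ (e * v2 + j)}"

definition D_ind :: "nat \<Rightarrow> nat \<Rightarrow> nat \<Rightarrow> 'K::{finite,field} \<Rightarrow> nat \<Rightarrow> int" where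
  "D_ind p m e \<beta> i = (if \<exists>x \<in> subfield_pm p m - {0}. - 1 = \<beta> ^ i * x ^ e then 1 else 0)"

definition mult_matrix :: "nat \<Rightarrow> nat \<Rightarrow> nat \<Rightarrow> 'K::{finite,field} \<Rightarrow> int mat" where
  "mult_matrix p m e \<beta> =
     mat e e (\<lambda>(i, j). int (cyc_num p m e \<beta> i j) - D_ind p m e \<beta> i * int (f_of p m e))"

definition d_comp :: "nat \<Rightarrow> int \<Rightarrow> 'a::comm_ring_1 mat \<Rightarrow> 'a mat \<Rightarrow> 'a mat" where
  "d_comp e d A B = mat e e (\<lambda>(i, j).
     (\<Sum>s<e. \<Sum>t<e. A $$ (s, t) *
        B $$ (nat ((d * int s + int i) mod int e), nat ((d * int t + int j) mod int e))))"

text \<open>n-fold (-1)-composition C * ... * C (n factors), for n >= 1.\<close>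
fun comp_power :: "nat \<Rightarrow> 'a::comm_ring_1 mat \<Rightarrow> nat \<Rightarrow> 'a mat" where
  "comp_power e A 0 = A"
| "comp_power e A (Suc 0) = A"
| "comp_power e A (Suc (Suc k)) = d_comp e (-1) A (comp_power e A (Suc k))"

end

theory Submission
  imports
    "HOL-Algebra.Algebraic_Closure_Type" "HOL-Combinatorics.Cycles" "HOL-Number_Theory.Residues"
    Defs
begin

text \<open>
  For \<open>z\<close> with \<open>z\<^sup>e = 1\<close> the discrete Fourier transform \<open>G(z) = \<Sum>\<^sub>i \<eta>(i) z\<^sup>i\<close> of the periods is the
  Gauss sum of the character sending the generator to \<open>z\<close>. The relation
  \<open>\<eta>(a) \<eta>(a + i) = \<Sum>\<^sub>j C(i, j) \<eta>(a + j)\<close> becomes \<open>G(x) G(1/(xy)) = C'(x, y) G(1/y)\<close>, where \<open>C'\<close> is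
  the two-dimensional Fourier transform of the multiplication matrix. As \<open>G\<close> never vanishes, \<open>C'\<close>
  is determined by \<open>G\<close>. The Hasse-Davenport relation says that \<open>G\<close> for the extension of degree
  \<open>n\<close> is \<open>(-1)\<^bsup>n-1\<^esup> G\<^sup>n\<close>; hence its \<open>C'\<close> is \<open>(-1)\<^bsup>n-1\<^esup> C'\<^sup>n\<close>, and the Fourier transform turns
  \<open>(-1)\<close>-composition into multiplication. The characteristic polynomial follows because the
  vectors \<open>(\<eta>(a + j))\<^sub>j\<close> form a basis of eigenvectors.

  The Hasse-Davenport relation itself comes from the \<open>L\<close>-series over the monic polynomials \<open>f\<close>
  with summands \<open>\<chi>(product of the roots) \<psi>(sum of the roots) T\<^bsup>deg f\<^esup>\<close>: it equals \<open>1 + G T\<close>, and the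
  coefficients of its logarithmic derivative are the Gauss sums of the extensions.
\<close>

lemma (in comm_monoid_set) nat_group_shift:
  fixes g :: "nat \<Rightarrow> 'a"
  shows "F (\<lambda>j. F (\<lambda>i. g (i + j * n)) {..<n}) {..<k} = F g {..<k * n}"
  using shift_bounds_nat_ivl[of g 0 _ n] nat_group[of g n k]
  by (simp add: lessThan_atLeast0 add.commute[of n])

section \<open>Polynomials over algebraically closed fields\<close>

lemma proots_prod_mset_linear: "proots (\<Prod>x\<in>#A. [:-x, 1:]) = (A :: 'a::idom multiset)"
proof -
  have "0 \<notin># image_mset (\<lambda>x. [:-x, 1:]) A" by auto
  from proots_prod_mset[OF this] show ?thesis by (simp add: image_mset.compositionality o_def)
qed

lemma size_proots_alg_closed: "size (proots f) = degree (f :: 'a::alg_closed_field poly)"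
  and alg_closed_poly_decompose_multiset:
    "smult (lead_coeff f) (\<Prod>x\<in>#proots f. [:-x, 1:]) = (f :: 'a::alg_closed_field poly)"
proof (atomize (full), cases "f = 0")
  case False
  then obtain A where A: "size A = degree f" "f = smult (lead_coeff f) (\<Prod>x\<in>#A. [:-x, 1:])"
    using alg_closed_imp_factorization by blast
  have "proots f = A"
    using False by (subst A(2)) (simp add: proots_prod_mset_linear)
  with A show "size (proots f) = degree f \<and> smult (lead_coeff f) (\<Prod>x\<in>#proots f. [:-x, 1:]) = f"
    by simp
qed simp

lemma sum_order_alg_closed:
  fixes f :: "'a::alg_closed_field poly"
  assumes "f \<noteq> 0"
  shows "(\<Sum>x | poly f x = 0. order x f) = degree f"
  using assms by (simp add: size_multiset_overloaded_eq flip: size_proots_alg_closed)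

lemma dvd_iff_proots_subseteq:
  fixes f g :: "'a::alg_closed_field poly"
  assumes "f \<noteq> 0" "g \<noteq> 0"
  shows "f dvd g \<longleftrightarrow> proots f \<subseteq># proots g"
proof
  assume "f dvd g"
  with assms show "proots f \<subseteq># proots g" by (auto simp: proots_mult elim!: dvdE)
next
  assume "proots f \<subseteq># proots g"
  hence "(\<Prod>x\<in>#proots f. [:-x, 1:]) dvd (\<Prod>x\<in>#proots g. [:-x, 1:])"
    by (intro prod_mset_subset_imp_dvd image_mset_subseteq_mono)
  hence "smult (lead_coeff f) (\<Prod>x\<in>#proots f. [:-x, 1:]) dvd
      smult (lead_coeff g) (\<Prod>x\<in>#proots g. [:-x, 1:])"
    using assms by (simp add: smult_dvd_iff dvd_smult)
  thus "f dvd g" by (simp only: alg_closed_poly_decompose_multiset)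
qed

definition power_fixpoint_poly :: "nat \<Rightarrow> 'a::idom poly" where
  "power_fixpoint_poly N = monom 1 N - monom 1 1"

lemma roots_power_fixpoint_poly: "{x. poly (power_fixpoint_poly N) x = 0} = {x. x ^ N = x}"
  by (simp add: power_fixpoint_poly_def poly_monom)

lemma degree_power_fixpoint_poly:
  assumes "N \<ge> 2"
  shows "degree (power_fixpoint_poly N :: 'a::idom poly) = N"
proof (rule antisym)
  show "degree (power_fixpoint_poly N :: 'a poly) \<le> N"
    unfolding power_fixpoint_poly_def using assms
    by (intro degree_diff_le) (auto intro: order.trans[OF degree_monom_le])
  show "N \<le> degree (power_fixpoint_poly N :: 'a poly)"
    using assms by (intro le_degree) (simp add: power_fixpoint_poly_def)
qed

lemma power_fixpoint_poly_nonzero: "N \<ge> 2 \<Longrightarrow> power_fixpoint_poly N \<noteq> (0 :: 'a::idom poly)"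
  using degree_power_fixpoint_poly[of N, where ?'a = 'a] by auto

lemma finite_power_eq_self: "N \<ge> 2 \<Longrightarrow> finite {x::'a::idom. x ^ N = x}"
  unfolding roots_power_fixpoint_poly[symmetric]
  by (intro poly_roots_finite power_fixpoint_poly_nonzero)

lemma card_power_eq_self_le: "N \<ge> 2 \<Longrightarrow> card {x::'a::idom. x ^ N = x} \<le> N"
  using card_poly_roots_bound[OF power_fixpoint_poly_nonzero, of N]
  by (simp add: roots_power_fixpoint_poly degree_power_fixpoint_poly)

lemma card_power_eq_self_alg_closed:
  assumes "N \<ge> 2" "of_nat N = (0::'a::alg_closed_field)"
  shows "card {x::'a. x ^ N = x} = N"
proof -
  let ?P = "power_fixpoint_poly N :: 'a poly"
  note nonzero = power_fixpoint_poly_nonzero[OF assms(1), where ?'a = 'a]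
  have pderiv: "pderiv ?P = [:-1:]"
    using assms(2) by (simp add: power_fixpoint_poly_def pderiv_diff pderiv_monom one_pCons)
  have simple: "order x ?P = 1" if "poly ?P x = 0" for x
  proof -
    have "\<not> [:-x, 1:] ^ 2 dvd ?P"
    proof
      assume "[:-x, 1:] ^ 2 dvd ?P"
      then obtain g where "?P = [:-x, 1:] * ([:-x, 1:] * g)"
        unfolding power2_eq_square mult.assoc dvd_def by blast
      hence "poly (pderiv ?P) x = 0" by (simp only: pderiv_mult poly_add poly_mult) simp
      with pderiv show False by simp
    qed
    hence "order x ?P < 2" using order_divides not_less by blast
    moreover have "order x ?P \<noteq> 0" using that nonzero by (simp add: order_root)
    ultimately show ?thesis by simp
  qed
  have "card {x::'a. x ^ N = x} = card {x. poly ?P x = 0}"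
    by (simp only: roots_power_fixpoint_poly)
  also have "\<dots> = (\<Sum>x | poly ?P x = 0. order x ?P)" by (simp add: simple)
  also have "\<dots> = N"
    using sum_order_alg_closed[OF nonzero] degree_power_fixpoint_poly[OF assms(1)] by simp
  finally show ?thesis .
qed

section \<open>The Hasse-Davenport relation\<close>

lemma funpow_eq_self_iff_least_power_dvd:
  assumes "(p ^^ n) x = x" "n > 0"
  shows "(p ^^ j) x = x \<longleftrightarrow> least_power p x dvd j"
proof
  have "(p ^^ (least_power p x * m)) x = x" for m
    using least_powerI(1)[OF assms] by (induction m) (simp_all add: funpow_add)
  thus "(p ^^ j) x = x" if "least_power p x dvd j" using that by auto
qed (rule least_power_minimal)

lemma inj_on_funpow_least_power:
  assumes "inj p" "(p ^^ n) x = x" "n > 0"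
  shows "inj_on (\<lambda>i. (p ^^ i) x) {..<least_power p x}"
proof (rule linorder_inj_onI', rule notI)
  fix a b assume ab: "a \<in> {..<least_power p x}" "b \<in> {..<least_power p x}" "a < b"
    and "(p ^^ a) x = (p ^^ b) x"
  hence "(p ^^ (b - a)) x = x" using assms(1) by (intro funpow_diff) auto
  hence "least_power p x \<le> b - a" using ab by (intro least_power_le) auto
  with ab show False by simp
qed

locale finite_fixpoints_endomorphism = field_hom frob
  for frob :: "'L::alg_closed_field \<Rightarrow> 'L" +
  assumes finite_funpow_fixpoints: "n > 0 \<Longrightarrow> finite {x. (frob ^^ n) x = x}"
begin

sublocale frob_poly: map_poly_inj_idom_divide_hom frob ..

text \<open>For the \<open>q\<close>-power map, \<open>Fix\<close> is the field with \<open>q\<close> elements and \<open>conj_poly j x\<close> is the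
  characteristic polynomial over it of \<open>x\<close> as an element of the extension of degree \<open>j\<close>.\<close>

definition Fix :: "'L set" where "Fix = {x. frob x = x}"

definition monics :: "nat \<Rightarrow> 'L poly set" where
  "monics k = {f. degree f = k \<and> lead_coeff f = 1 \<and> map_poly frob f = f}"

definition conj_poly :: "nat \<Rightarrow> 'L \<Rightarrow> 'L poly" where
  "conj_poly j x = (\<Prod>i<j. [:- (frob ^^ i) x, 1:])"

lemma Fix_closed:
  "x \<in> Fix \<Longrightarrow> y \<in> Fix \<Longrightarrow> x + y \<in> Fix" "x \<in> Fix \<Longrightarrow> y \<in> Fix \<Longrightarrow> x * y \<in> Fix"
  "x \<in> Fix \<Longrightarrow> - x \<in> Fix" "0 \<in> Fix" "1 \<in> Fix" "x \<in> Fix \<Longrightarrow> x ^ k \<in> Fix"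
  by (auto simp: Fix_def hom_distribs)

lemma monics_nonzero: "f \<in> monics k \<Longrightarrow> f \<noteq> 0"
  by (auto simp: monics_def)

lemma coeff_monics_in_Fix: "f \<in> monics k \<Longrightarrow> coeff f i \<in> Fix"
  by (auto simp: monics_def Fix_def poly_eq_iff)

lemma finite_monics: "finite (monics k)"
proof (rule finite_subset)
  show "monics k \<subseteq> Poly ` {xs. set xs \<subseteq> Fix \<and> length xs \<le> Suc k}"
  proof
    fix f assume f: "f \<in> monics k"
    hence "set (coeffs f) \<subseteq> Fix" "length (coeffs f) \<le> Suc k"
      using coeff_monics_in_Fix[OF f] by (auto simp: monics_def coeffs_def)
    thus "f \<in> Poly ` {xs. set xs \<subseteq> Fix \<and> length xs \<le> Suc k}"
      by (intro image_eqI[of _ _ "coeffs f"]) auto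
  qed
  have "finite Fix" unfolding Fix_def using finite_funpow_fixpoints[of 1] by simp
  thus "finite (Poly ` {xs. set xs \<subseteq> Fix \<and> length xs \<le> Suc k})"
    by (intro finite_imageI finite_lists_length_le)
qed

lemma monics_mult_iff:
  assumes "f \<in> monics j"
  shows "f * g \<in> monics (j + k) \<longleftrightarrow> g \<in> monics k"
proof (cases "g = 0")
  case False
  have f: "f \<noteq> 0" "degree f = j" "coeff f j = 1" "map_poly frob f = f"
    using assms by (auto simp: monics_def)
  have "degree (f * g) = j + degree g" using False f by (simp add: degree_mult_eq)
  moreover have "lead_coeff (f * g) = lead_coeff g" using f unfolding lead_coeff_mult by simp
  moreover have "map_poly frob (f * g) = f * g \<longleftrightarrow> map_poly frob g = g"
    using f by (simp add: frob_poly.hom_mult)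
  ultimately show ?thesis by (simp only: monics_def mem_Collect_eq) simp
qed (simp add: monics_def)

lemma monics_diff_monom:
  assumes "f \<in> monics k" "c \<in> Fix" "j < k"
  shows "f - monom c j \<in> monics k"
proof -
  have "degree (- monom c j) < degree f"
    using assms degree_monom_le[of c j] by (auto simp: monics_def)
  hence "degree (f - monom c j) = degree f"
    unfolding diff_conv_add_uminus by (rule degree_add_eq_left)
  moreover have "map_poly frob (f - monom c j) = f - monom c j"
    using assms by (simp add: monics_def frob_poly.hom_minus Fix_def)
  ultimately show ?thesis using assms by (auto simp: monics_def)
qed

lemma degree_conj_poly: "degree (conj_poly j x) = j"
  unfolding conj_poly_def by (subst degree_prod_sum_eq) auto

lemma conj_poly_in_monics:
  assumes "(frob ^^ j) x = x"
  shows "conj_poly j x \<in> monics j"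
proof -
  let ?l = "\<lambda>i. [:- (frob ^^ i) x, 1:]"
  have "map_poly frob (conj_poly j x) = (\<Prod>i<j. ?l (Suc i))"
    unfolding conj_poly_def frob_poly.hom_prod by (simp add: hom_uminus)
  moreover have "?l 0 * (\<Prod>i<j. ?l (Suc i)) = ?l 0 * conj_poly j x"
    using prod.lessThan_Suc_shift[of ?l j] assms
    by (simp add: conj_poly_def mult.commute del: mult_pCons_left mult_pCons_right)
  ultimately have "?l 0 * map_poly frob (conj_poly j x) = ?l 0 * conj_poly j x" by (simp only:)
  hence "map_poly frob (conj_poly j x) = conj_poly j x"
    by (rule mult_left_cancel[THEN iffD1, rotated]) simp
  moreover have "lead_coeff (conj_poly j x) = 1"
    unfolding conj_poly_def lead_coeff_prod by simp
  ultimately show ?thesis by (simp add: monics_def degree_conj_poly)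
qed

lemma order_frob_funpow:
  assumes "f \<in> monics k"
  shows "order ((frob ^^ i) x) f = order x f"
proof (induction i)
  case (Suc i)
  have "order (frob ((frob ^^ i) x)) (map_poly frob f) = order ((frob ^^ i) x) f"
    by (rule frob_poly.order_hom)
  with Suc assms show ?case by (simp add: monics_def)
qed simp

lemma root_imp_periodic:
  assumes "f \<in> monics k" "poly f x = 0"
  obtains n where "(frob ^^ n) x = x" "n > 0"
proof -
  have "{y. \<exists>n. y = (frob ^^ n) x} \<subseteq> {y. poly f y = 0}"
    using order_frob_funpow[OF assms(1), of _ x] assms(2) monics_nonzero[OF assms(1)]
    by (auto simp: order_root)
  hence "finite {y. \<exists>n. y = (frob ^^ n) x}"
    using poly_roots_finite[OF monics_nonzero[OF assms(1)]] by (rule finite_subset)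
  from funpow_inj_finite[OF inj_f this] that show ?thesis by metis
qed

lemma conj_poly_power:
  assumes "(frob ^^ d) x = x"
  shows "conj_poly (d * m) x = conj_poly d x ^ m"
proof -
  have "(frob ^^ (k * d)) x = x" for k
    using assms by (induction k) (simp_all add: funpow_add)
  hence "(\<Prod>k<m. \<Prod>i<d. [:- (frob ^^ (i + k * d)) x, 1:]) = conj_poly d x ^ m"
    by (simp add: conj_poly_def funpow_add)
  thus ?thesis
    using prod.nat_group_shift[of "\<lambda>i. [:- (frob ^^ i) x, 1:]" d m]
    by (simp add: conj_poly_def mult.commute)
qed

lemma proots_conj_poly_least_power:
  assumes "(frob ^^ n) x = x" "n > 0"
  shows "proots (conj_poly (least_power frob x) x) =
    mset_set ((\<lambda>i. (frob ^^ i) x) ` {..<least_power frob x})"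
proof -
  have "conj_poly (least_power frob x) x =
      (\<Prod>y\<in>(\<lambda>i. (frob ^^ i) x) ` {..<least_power frob x}. [:-y, 1:])"
    unfolding conj_poly_def
    by (subst prod.reindex[OF inj_on_funpow_least_power[OF inj_f assms]]) simp
  thus ?thesis by (simp add: prod_unfold_prod_mset proots_prod_mset_linear)
qed

lemma conj_poly_least_power_dvd_iff:
  assumes f: "f \<in> monics k" and n: "(frob ^^ n) x = x" "n > 0"
  shows "conj_poly (least_power frob x * m) x dvd f \<longleftrightarrow> m \<le> order x f"
proof -
  define d where "d = least_power frob x"
  define orbit where "orbit = (\<lambda>i. (frob ^^ i) x) ` {..<d}"
  have d: "(frob ^^ d) x = x" "d > 0" unfolding d_def by (rule least_powerI[OF n])+
  have "conj_poly (d * m) x \<noteq> 0" by (simp add: conj_poly_def)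
  hence "conj_poly (d * m) x dvd f \<longleftrightarrow> proots (conj_poly (d * m) x) \<subseteq># proots f"
    by (rule dvd_iff_proots_subseteq[OF _ monics_nonzero[OF f]])
  also have "proots (conj_poly (d * m) x) = repeat_mset m (mset_set orbit)"
    unfolding conj_poly_power[OF d(1)] proots_power
    using proots_conj_poly_least_power[OF n] by (simp add: orbit_def d_def)
  also have "\<dots> \<subseteq># proots f \<longleftrightarrow> (\<forall>y\<in>orbit. m \<le> order y f)"
    using monics_nonzero[OF f] by (auto simp: subseteq_mset_def count_mset_set' orbit_def)
  also have "\<dots> \<longleftrightarrow> m \<le> order x f"
    using d(2) order_frob_funpow[OF f] by (auto simp: orbit_def)
  finally show ?thesis by (simp add: d_def)
qed

text \<open>If \<open>x\<close> has \<open>d\<close> conjugates, the degrees counted here are \<open>d, 2d, \<dots>, order x f \<cdot> d\<close>.\<close>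

lemma card_conj_poly_dvd_degrees:
  assumes f: "f \<in> monics k" and root: "poly f x = 0"
  shows "card {j \<in> {1..k}. (frob ^^ j) x = x \<and> conj_poly j x dvd f} = order x f"
proof -
  obtain n where n: "(frob ^^ n) x = x" "n > 0" using root_imp_periodic[OF f root] .
  define d where "d = least_power frob x"
  have d: "d > 0" unfolding d_def by (rule least_powerI[OF n])
  note dvd_iff = conj_poly_least_power_dvd_iff[OF f n, folded d_def]
  note period_iff = funpow_eq_self_iff_least_power_dvd[OF n, folded d_def]
  have "{j \<in> {1..k}. (frob ^^ j) x = x \<and> conj_poly j x dvd f} = (\<lambda>m. d * m) ` {1..order x f}"
  proof (intro equalityI subsetI)
    fix j assume "j \<in> {j \<in> {1..k}. (frob ^^ j) x = x \<and> conj_poly j x dvd f}"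
    then obtain m where "j = d * m" "m > 0" "conj_poly (d * m) x dvd f"
      by (auto simp: period_iff elim!: dvdE intro: Suc_leI)
    thus "j \<in> (\<lambda>m. d * m) ` {1..order x f}" by (auto simp: dvd_iff Suc_le_eq)
  next
    fix j assume "j \<in> (\<lambda>m. d * m) ` {1..order x f}"
    then obtain m where "j = d * m" "m \<in> {1..order x f}" by (rule imageE)
    hence m: "j = d * m" "m > 0" "m \<le> order x f" by auto
    have dvd: "conj_poly j x dvd f" using m dvd_iff by simp
    hence "j \<le> k"
      using dvd_imp_degree_le[OF dvd monics_nonzero[OF f]] f
      by (simp add: degree_conj_poly monics_def)
    with m d dvd show "j \<in> {j \<in> {1..k}. (frob ^^ j) x = x \<and> conj_poly j x dvd f}"
      by (simp add: period_iff Suc_le_eq)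
  qed
  thus ?thesis using d by (simp add: card_image inj_on_def)
qed

lemma conj_poly_dvd_imp_root:
  assumes "conj_poly j x dvd f" "j > 0"
  shows "poly f x = 0"
proof -
  have "poly (conj_poly j x) x = 0"
    using assms(2) by (auto simp: conj_poly_def poly_prod intro!: prod_zero bexI[of _ 0])
  thus ?thesis using assms(1) by (auto elim!: dvdE)
qed

lemma sum_card_conj_poly_divisors:
  assumes f: "f \<in> monics k"
  shows "(\<Sum>j=1..k. card {x. (frob ^^ j) x = x \<and> conj_poly j x dvd f}) = k"
proof -
  let ?roots = "{x. poly f x = 0}"
  let ?P = "\<lambda>j x. (frob ^^ j) x = x \<and> conj_poly j x dvd f"
  have "(\<Sum>j=1..k. card {x. ?P j x}) = (\<Sum>j=1..k. \<Sum>x | x \<in> ?roots \<and> ?P j x. 1)"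
    using conj_poly_dvd_imp_root[of _ _ f] by (auto intro!: sum.cong arg_cong[of _ _ card])
  also have "\<dots> = (\<Sum>x\<in>?roots. \<Sum>j | j \<in> {1..k} \<and> ?P j x. 1)"
    by (intro sum.swap_restrict poly_roots_finite monics_nonzero[OF f]) simp
  also have "\<dots> = (\<Sum>x\<in>?roots. order x f)"
    using card_conj_poly_dvd_degrees[OF f] by (intro sum.cong) simp_all
  also have "\<dots> = k" using sum_order_alg_closed[OF monics_nonzero[OF f]] f by (simp add: monics_def)
  finally show ?thesis .
qed

end

locale hasse_davenport = finite_fixpoints_endomorphism frob
  for frob :: "'L::alg_closed_field \<Rightarrow> 'L" +
  fixes \<chi> \<psi> :: "'L \<Rightarrow> 'c::idom"
  assumes chi_mult: "x \<in> Fix \<Longrightarrow> y \<in> Fix \<Longrightarrow> \<chi> (x * y) = \<chi> x * \<chi> y"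
    and chi_1: "\<chi> 1 = 1"
    and psi_add: "x \<in> Fix \<Longrightarrow> y \<in> Fix \<Longrightarrow> \<psi> (x + y) = \<psi> x * \<psi> y"
    and psi_0: "\<psi> 0 = 1"
    and psi_nontrivial: "\<exists>c \<in> Fix. \<psi> c \<noteq> 1"
begin

text \<open>For a monic \<open>f\<close> this is \<open>\<chi>\<close> of the product of the roots times \<open>\<psi>\<close> of their sum;
  reading the second highest coefficient off the reversed polynomial also covers degree 0.\<close>

definition poly_char :: "'L poly \<Rightarrow> 'c" where
  "poly_char f = \<chi> ((-1) ^ degree f * coeff f 0) * \<psi> (- coeff (reflect_poly f) 1)"

definition poly_char_sum :: "nat \<Rightarrow> 'c" where
  "poly_char_sum k = (\<Sum>f\<in>monics k. poly_char f)"

definition lifted_gauss_sum :: "nat \<Rightarrow> 'c" where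
  "lifted_gauss_sum j =
    (\<Sum>x | (frob ^^ j) x = x. \<chi> (\<Prod>i<j. (frob ^^ i) x) * \<psi> (\<Sum>i<j. (frob ^^ i) x))"

lemma coeff_reflect_monics_in_Fix: "f \<in> monics k \<Longrightarrow> coeff (reflect_poly f) i \<in> Fix"
  by (simp add: coeff_reflect_poly coeff_monics_in_Fix Fix_closed)

lemma poly_char_mult:
  assumes f: "f \<in> monics j" and g: "g \<in> monics k"
  shows "poly_char (f * g) = poly_char f * poly_char g"
proof -
  have fg: "f \<noteq> 0" "g \<noteq> 0" "lead_coeff f = 1" "lead_coeff g = 1"
    using assms by (auto simp: monics_def)
  have "\<chi> ((-1) ^ degree (f * g) * coeff (f * g) 0) =
      \<chi> ((-1) ^ degree f * coeff f 0) * \<chi> ((-1) ^ degree g * coeff g 0)"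
    using fg assms
    by (subst chi_mult[symmetric])
      (simp_all add: degree_mult_eq power_add coeff_mult Fix_closed coeff_monics_in_Fix mult_ac)
  moreover have "\<psi> (- coeff (reflect_poly (f * g)) 1) =
      \<psi> (- coeff (reflect_poly f) 1) * \<psi> (- coeff (reflect_poly g) 1)"
    using fg Fix_closed(3)[OF coeff_reflect_monics_in_Fix[OF f]]
      Fix_closed(3)[OF coeff_reflect_monics_in_Fix[OF g]]
    by (subst psi_add[symmetric])
      (simp_all add: reflect_poly_mult coeff_mult coeff_reflect_poly[of _ 0] algebra_simps)
  ultimately show ?thesis by (simp add: poly_char_def)
qed

lemma poly_char_conj_poly:
  "poly_char (conj_poly j x) = \<chi> (\<Prod>i<j. (frob ^^ i) x) * \<psi> (\<Sum>i<j. (frob ^^ i) x)"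
proof -
  have norm: "(-1) ^ j * coeff (conj_poly j x) 0 = (\<Prod>i<j. (frob ^^ i) x)"
    by (simp add: conj_poly_def poly_prod prod_uminus flip: poly_0_coeff_0 power_add mult.assoc)
  have "coeff (reflect_poly (conj_poly j x)) 0 = 1 \<and>
      coeff (reflect_poly (conj_poly j x)) 1 = - (\<Sum>i<j. (frob ^^ i) x)"
  proof (induction j)
    case (Suc j)
    have "reflect_poly (conj_poly (Suc j) x) =
        reflect_poly (conj_poly j x) * [:1, - (frob ^^ j) x:]"
      by (simp add: conj_poly_def reflect_poly_mult reflect_poly_def[of "[:_, _:]"]
          del: mult_pCons_right)
    with Suc show ?case by (simp add: coeff_mult)
  qed (simp add: conj_poly_def)
  with norm show ?thesis by (simp add: poly_char_def degree_conj_poly)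
qed

lemma poly_char_sum_0: "poly_char_sum 0 = 1"
proof -
  have "monics 0 = {1}" by (auto simp: monics_def elim!: degree_eq_zeroE)
  thus ?thesis by (simp add: poly_char_sum_def poly_char_def chi_1 psi_0)
qed

text \<open>Adding \<open>c\<close> to the second highest coefficient permutes the monic polynomials and multiplies
  \<^term>\<open>poly_char\<close> by \<open>\<psi> (-c)\<close>.\<close>

lemma poly_char_sum_eq_0:
  assumes "k \<ge> 2"
  shows "poly_char_sum k = 0"
proof -
  obtain c where c: "c \<in> Fix" "\<psi> c \<noteq> 1" using psi_nontrivial by blast
  define shift where "shift c f = f - monom c (k - 1)" for c :: 'L and f
  have shift_in: "shift c f \<in> monics k" if "f \<in> monics k" "c \<in> Fix" for c f
    unfolding shift_def using that assms by (intro monics_diff_monom) auto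
  have "poly_char_sum k = (\<Sum>f\<in>monics k. poly_char (shift c f))"
    unfolding poly_char_sum_def
  proof (rule sum.reindex_bij_witness[of _ "shift c" "shift (-c)"])
    show "shift c f \<in> monics k" "shift (-c) f \<in> monics k" if "f \<in> monics k" for f
      using that c(1) by (auto intro: shift_in Fix_closed)
  qed (simp_all add: shift_def flip: minus_monom)
  also have "\<dots> = (\<Sum>f\<in>monics k. \<psi> c * poly_char f)"
  proof (rule sum.cong[OF refl])
    fix f assume f: "f \<in> monics k"
    have "degree (shift c f) = k" "degree f = k"
      using shift_in[OF f c(1)] f by (auto simp: monics_def)
    thus "poly_char (shift c f) = \<psi> c * poly_char f"
      using assms psi_add[OF _ c(1), of "- coeff f (k - 1)"] coeff_monics_in_Fix[OF f, of "k - 1"]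
      by (simp add: shift_def poly_char_def coeff_reflect_poly Fix_closed)
  qed
  also have "\<dots> = \<psi> c * poly_char_sum k" by (simp add: poly_char_sum_def sum_distrib_left)
  finally show ?thesis using c by simp
qed

lemma sum_poly_char_multiples:
  assumes "g \<in> monics j" "j \<le> k"
  shows "(\<Sum>f | f \<in> monics k \<and> g dvd f. poly_char f) = poly_char g * poly_char_sum (k - j)"
proof -
  have "g * h \<in> monics k \<longleftrightarrow> h \<in> monics (k - j)" for h
    using monics_mult_iff[OF assms(1), of h "k - j"] assms(2) by simp
  hence "{f \<in> monics k. g dvd f} = (\<lambda>h. g * h) ` monics (k - j)" by (force elim!: dvdE)
  moreover have "inj_on (\<lambda>h. g * h) (monics (k - j))"
    using monics_nonzero[OF assms(1)] by (simp add: inj_on_def)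
  ultimately have "(\<Sum>f | f \<in> monics k \<and> g dvd f. poly_char f) =
      (\<Sum>h\<in>monics (k - j). poly_char (g * h))"
    by (simp add: sum.reindex)
  thus ?thesis
    using poly_char_mult[OF assms(1)] by (simp add: poly_char_sum_def sum_distrib_left)
qed

text \<open>The coefficientwise form of the logarithmic derivative of the \<open>L\<close>-series
  \<open>\<Sum>\<^sub>k poly_char_sum k T\<^sup>k\<close>.\<close>

lemma poly_char_sum_recurrence:
  "of_nat k * poly_char_sum k = (\<Sum>j=1..k. lifted_gauss_sum j * poly_char_sum (k - j))"
proof -
  let ?R = "\<lambda>j. {x. (frob ^^ j) x = x}"
  have "lifted_gauss_sum j * poly_char_sum (k - j) =
      (\<Sum>f\<in>monics k. of_nat (card {x. (frob ^^ j) x = x \<and> conj_poly j x dvd f}) * poly_char f)"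
    if j: "j \<in> {1..k}" for j
  proof -
    have "lifted_gauss_sum j * poly_char_sum (k - j) =
        (\<Sum>x\<in>?R j. \<Sum>f | f \<in> monics k \<and> conj_poly j x dvd f. poly_char f)"
      unfolding lifted_gauss_sum_def sum_distrib_right
      using j by (intro sum.cong refl)
        (simp add: sum_poly_char_multiples[OF conj_poly_in_monics] poly_char_conj_poly)
    also have "\<dots> = (\<Sum>f\<in>monics k. \<Sum>x | x \<in> ?R j \<and> conj_poly j x dvd f. poly_char f)"
      using j by (intro sum.swap_restrict finite_funpow_fixpoints finite_monics) auto
    finally show ?thesis by simp
  qed
  hence "(\<Sum>j=1..k. lifted_gauss_sum j * poly_char_sum (k - j)) = (\<Sum>f\<in>monics k.
      (\<Sum>j=1..k. of_nat (card {x. (frob ^^ j) x = x \<and> conj_poly j x dvd f})) * poly_char f)"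
    by (simp add: sum_distrib_right sum.swap[of _ "monics k"])
  also have "\<dots> = (\<Sum>f\<in>monics k. of_nat k * poly_char f)"
    by (intro sum.cong refl) (simp only: sum_card_conj_poly_divisors flip: of_nat_sum)
  finally show ?thesis by (simp add: poly_char_sum_def sum_distrib_left)
qed

lemma lifted_gauss_sum_Suc:
  "lifted_gauss_sum (Suc m) = (-1) ^ m * lifted_gauss_sum 1 ^ Suc m"
proof (induction m)
  case (Suc m)
  have "poly_char_sum 1 = lifted_gauss_sum 1"
    using poly_char_sum_recurrence[of 1] by (simp add: poly_char_sum_0)
  have "0 = (\<Sum>j=1..Suc (Suc m). lifted_gauss_sum j * poly_char_sum (Suc (Suc m) - j))"
    using poly_char_sum_recurrence[of "Suc (Suc m)"] by (simp add: poly_char_sum_eq_0)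
  also have "\<dots> = (\<Sum>j\<in>{Suc m, Suc (Suc m)}. lifted_gauss_sum j * poly_char_sum (Suc (Suc m) - j))"
    by (rule sum.mono_neutral_right) (auto intro!: poly_char_sum_eq_0)
  also have "\<dots> = lifted_gauss_sum (Suc m) * lifted_gauss_sum 1 + lifted_gauss_sum (Suc (Suc m))"
    using \<open>poly_char_sum 1 = _\<close> by (simp add: poly_char_sum_0)
  finally show ?case using Suc by (simp add: eq_neg_iff_add_eq_0 algebra_simps)
qed simp

theorem hasse_davenport:
  assumes "n \<ge> 1"
  shows "(\<Sum>x | (frob ^^ n) x = x. \<chi> (\<Prod>i<n. (frob ^^ i) x) * \<psi> (\<Sum>i<n. (frob ^^ i) x)) =
    (-1) ^ (n - 1) * (\<Sum>x\<in>Fix. \<chi> x * \<psi> x) ^ n"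
  using lifted_gauss_sum_Suc[of "n - 1"] assms by (simp add: lifted_gauss_sum_def Fix_def)

end

section \<open>The discrete Fourier transform\<close>

definition periodic :: "nat \<Rightarrow> (nat \<Rightarrow> 'a) \<Rightarrow> bool" where
  "periodic e h \<longleftrightarrow> (\<forall>i. h (i + e) = h i)"

lemma periodic_mod:
  assumes "periodic e h"
  shows "h (i mod e) = h i"
proof -
  have "h (i mod e + k * e) = h (i mod e)" for k
  proof (induction k)
    case (Suc k)
    have "h (i mod e + Suc k * e) = h ((i mod e + k * e) + e)" by (simp add: algebra_simps)
    with Suc assms show ?case by (simp add: periodic_def)
  qed simp
  from this[of "i div e"] show ?thesis by simp
qed

lemma sum_periodic_shift:
  fixes h :: "nat \<Rightarrow> 'a::cancel_comm_monoid_add"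
  assumes "periodic e h"
  shows "(\<Sum>i<e. h (i + m)) = (\<Sum>i<e. h i)"
proof (induction m)
  case (Suc m)
  have "h m + (\<Sum>i<e. h (i + Suc m)) = (\<Sum>i<Suc e. h (i + m))"
    unfolding sum.lessThan_Suc_shift by simp
  also have "\<dots> = h m + (\<Sum>i<e. h (i + m))"
    using assms by (simp add: periodic_def add.commute[of e m] add.commute[of "h m"])
  finally show ?case using Suc by simp
qed simp

definition dft :: "nat \<Rightarrow> (nat \<Rightarrow> 'a::comm_ring_1) \<Rightarrow> 'a \<Rightarrow> 'a" where
  "dft e h x = (\<Sum>i<e. h i * x ^ i)"

lemma dft_cong: "(\<And>i. i < e \<Longrightarrow> g i = h i) \<Longrightarrow> dft e g x = dft e h x"
  by (simp add: dft_def)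

lemma dft_cmult: "dft e (\<lambda>i. c * h i) x = c * dft e h x"
  by (simp add: dft_def sum_distrib_left mult.assoc)

lemma dft_cmult_right: "dft e (\<lambda>i. h i * c) x = dft e h x * c"
  using dft_cmult[of e c h x] by (simp add: mult.commute)

lemma dft_diff: "dft e (\<lambda>i. g i - h i) x = dft e g x - dft e h x"
  by (simp add: dft_def left_diff_distrib sum_subtractf)

lemma dft_sum: "dft e (\<lambda>i. \<Sum>s\<in>S. g s i) x = (\<Sum>s\<in>S. dft e (g s) x)"
  by (simp add: dft_def sum_distrib_right sum.swap[of _ S])

lemma dft_shift:
  assumes "periodic e h" "x ^ e = 1"
  shows "x ^ m * dft e (\<lambda>i. h (i + m)) x = dft e h x"
proof -
  have "periodic e (\<lambda>i. h i * x ^ i)" using assms by (simp add: periodic_def power_add)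
  from sum_periodic_shift[OF this, of m] show ?thesis
    by (simp add: dft_def sum_distrib_left power_add mult_ac)
qed

lemma dft_shift_inverse:
  fixes x :: "'a::field"
  assumes "periodic e h" "x ^ e = 1" "e > 0"
  shows "dft e (\<lambda>i. h (i + m)) (inverse x) = x ^ m * dft e h (inverse x)"
proof -
  have "x \<noteq> 0" using assms(2,3) by (auto simp: power_0_left)
  thus ?thesis
    using dft_shift[OF assms(1), of "inverse x" m] assms(2) by (simp add: field_simps)
qed

lemma dft_cyclic_diff:
  assumes "x ^ e = 1"
  shows "dft e (\<lambda>i. h (nat ((int i - int s) mod int e))) x = x ^ s * dft e h x"
proof -
  let ?g = "\<lambda>i. h (nat ((int i - int s) mod int e))"
  have "int (i + e) - int s = int i - int s + int e" for i by simp
  hence "periodic e ?g" by (simp only: periodic_def mod_add_self2) simp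
  from dft_shift[OF this assms, of s] have "dft e ?g x = x ^ s * dft e (\<lambda>i. ?g (i + s)) x" ..
  also have "dft e (\<lambda>i. ?g (i + s)) x = dft e h x" by (rule dft_cong) simp
  finally show ?thesis .
qed

lemma dft_mult_dft:
  assumes "periodic e h" "x ^ e = 1"
  shows "dft e h x * dft e g y = dft e (\<lambda>i. dft e (\<lambda>a. g a * h (a + i)) (x * y)) x"
proof -
  have "dft e h x * dft e g y = (\<Sum>a<e. g a * y ^ a * dft e h x)"
    by (simp add: dft_def[of e g] sum_distrib_left mult_ac)
  also have "\<dots> = (\<Sum>a<e. g a * (x * y) ^ a * dft e (\<lambda>i. h (i + a)) x)"
  proof (rule sum.cong[OF refl])
    fix a
    show "g a * y ^ a * dft e h x = g a * (x * y) ^ a * dft e (\<lambda>i. h (i + a)) x"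
      unfolding dft_shift[OF assms, of a, symmetric] by (simp add: power_mult_distrib mult_ac)
  qed
  also have "\<dots> = (\<Sum>a<e. dft e (\<lambda>i. g a * h (a + i) * (x * y) ^ a) x)"
    by (simp add: dft_cmult_right dft_cmult add.commute mult_ac)
  finally show ?thesis by (simp only: dft_def[of e _ "x * y"] dft_sum)
qed

lemma dft_eq_0_imp:
  fixes h :: "nat \<Rightarrow> 'a::idom"
  assumes "card {z::'a. z ^ e = 1} = e" "\<And>z. z ^ e = 1 \<Longrightarrow> dft e h z = 0" "i < e"
  shows "h i = 0"
proof -
  define P where "P = (\<Sum>i<e. monom (h i) i)"
  have coeff: "coeff P i = (if i < e then h i else 0)" for i
    by (simp add: P_def coeff_sum)
  have "P = 0"
  proof (rule ccontr)
    assume P: "P \<noteq> 0"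
    have "{z. z ^ e = 1} \<subseteq> {z. poly P z = 0}"
      using assms(2) by (auto simp: P_def dft_def poly_sum poly_monom)
    hence "card {z::'a. z ^ e = 1} \<le> card {z. poly P z = 0}"
      using poly_roots_finite[OF P] by (intro card_mono)
    also have "\<dots> \<le> degree P" using P by (rule card_poly_roots_bound)
    also have "\<dots> < e"
      using P coeff[of "degree P"] leading_coeff_0_iff[of P] by (auto split: if_splits)
    finally show False using assms(1) by simp
  qed
  thus ?thesis using coeff[of i] assms(3) by simp
qed

definition dft2 :: "nat \<Rightarrow> 'a::comm_ring_1 mat \<Rightarrow> 'a \<Rightarrow> 'a \<Rightarrow> 'a" where
  "dft2 e A x y = dft e (\<lambda>i. dft e (\<lambda>j. A $$ (i, j)) y) x"

lemma dft2_smult: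
  assumes "A \<in> carrier_mat e e"
  shows "dft2 e (c \<cdot>\<^sub>m A) x y = c * dft2 e A x y"
proof -
  have "dft2 e (c \<cdot>\<^sub>m A) x y = dft e (\<lambda>i. dft e (\<lambda>j. c * A $$ (i, j)) y) x"
    unfolding dft2_def using assms by (intro dft_cong) auto
  thus ?thesis by (simp only: dft2_def dft_cmult)
qed

lemma mat_eqI_dft2:
  fixes A B :: "'a::idom mat"
  assumes "card {z::'a. z ^ e = 1} = e" "A \<in> carrier_mat e e" "B \<in> carrier_mat e e"
    and eq: "\<And>x y. x ^ e = 1 \<Longrightarrow> y ^ e = 1 \<Longrightarrow> dft2 e A x y = dft2 e B x y"
  shows "A = B"
proof (rule eq_matI)
  fix i j assume "i < dim_row B" "j < dim_col B"
  hence ij: "i < e" "j < e" using assms by auto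
  have "dft e (\<lambda>j. A $$ (i, j) - B $$ (i, j)) y = 0" if "y ^ e = 1" for y
  proof (rule dft_eq_0_imp[OF assms(1) _ ij(1)])
    show "dft e (\<lambda>i. dft e (\<lambda>j. A $$ (i, j) - B $$ (i, j)) y) x = 0" if "x ^ e = 1" for x
      using eq[OF that \<open>y ^ e = 1\<close>] by (simp add: dft_diff dft2_def)
  qed
  from dft_eq_0_imp[OF assms(1) this ij(2)] show "A $$ (i, j) = B $$ (i, j)" by simp
qed (use assms in auto)

lemma dft2_d_comp:
  assumes "x ^ e = 1" "y ^ e = 1"
  shows "dft2 e (d_comp e (-1) A B) x y = dft2 e A x y * dft2 e B x y"
proof -
  define \<sigma> where "\<sigma> s i = nat ((int i - int s) mod int e)" for s i
  have shift_row: "dft e (\<lambda>i. dft e (\<lambda>j. B $$ (\<sigma> s i, j)) y) x = x ^ s * dft2 e B x y" for s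
    unfolding \<sigma>_def dft2_def by (rule dft_cyclic_diff[OF assms(1)])
  have shift_col: "dft e (\<lambda>j. B $$ (k, \<sigma> t j)) y = y ^ t * dft e (\<lambda>j. B $$ (k, j)) y" for k t
    unfolding \<sigma>_def by (rule dft_cyclic_diff[OF assms(2)])
  have "dft2 e (d_comp e (-1) A B) x y =
      dft e (\<lambda>i. dft e (\<lambda>j. \<Sum>s<e. \<Sum>t<e. A $$ (s, t) * B $$ (\<sigma> s i, \<sigma> t j)) y) x"
    unfolding dft2_def by (intro dft_cong) (simp add: d_comp_def \<sigma>_def)
  also have "\<dots> = (\<Sum>s<e. \<Sum>t<e. A $$ (s, t) * dft e (\<lambda>i. dft e (\<lambda>j. B $$ (\<sigma> s i, \<sigma> t j)) y) x)"
    by (simp only: dft_sum dft_cmult)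
  also have "\<dots> = (\<Sum>s<e. \<Sum>t<e. A $$ (s, t) * (y ^ t * (x ^ s * dft2 e B x y)))"
    by (simp only: shift_col dft_cmult shift_row)
  also have "\<dots> = dft2 e A x y * dft2 e B x y"
    by (simp add: dft2_def[of e A] dft_def sum_distrib_left sum_distrib_right mult_ac)
  finally show ?thesis .
qed

lemma comp_power_carrier:
  "A \<in> carrier_mat e e \<Longrightarrow> comp_power e A n \<in> carrier_mat e e"
  by (induction e A n rule: comp_power.induct) (auto simp: d_comp_def)

lemma dft2_comp_power:
  assumes "x ^ e = 1" "y ^ e = 1" "n \<ge> 1"
  shows "dft2 e (comp_power e A n) x y = dft2 e A x y ^ n"
  using assms by (induction e A n rule: comp_power.induct) (auto simp: dft2_d_comp)

lemma (in comm_ring_hom) mat_hom_comp_power: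
  assumes "A \<in> carrier_mat e e"
  shows "map_mat hom (comp_power e A n) = comp_power e (map_mat hom A) n"
  using assms
proof (induction e A n rule: comp_power.induct)
  case (3 e A k)
  have index: "nat ((int i - int s) mod int e) < e" if "i < e" for i s
    using that by (simp add: nat_less_iff)
  have "map_mat hom (d_comp e (-1) A (comp_power e A (Suc k))) =
      d_comp e (-1) (map_mat hom A) (map_mat hom (comp_power e A (Suc k)))"
    using 3(2) comp_power_carrier[OF 3(2), of "Suc k"]
    by (intro eq_matI) (auto simp: d_comp_def hom_distribs index intro!: sum.cong)
  with 3 show ?case by simp
qed simp_all

section \<open>Multiplication matrices\<close>

locale multiplication_matrix =
  fixes e :: nat and h :: "nat \<Rightarrow> 'a::field" and A :: "'a mat"
  assumes e_pos: "e > 0"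
    and card_roots_of_unity: "card {z::'a. z ^ e = 1} = e"
    and periodic: "periodic e h"
    and carrier: "A \<in> carrier_mat e e"
    and mult_shift: "i < e \<Longrightarrow> h a * h (a + i) = (\<Sum>j<e. A $$ (i, j) * h (a + j))"
begin

lemma dft_mult_dft_inverse:
  assumes "x ^ e = 1" "y ^ e = 1"
  shows "dft e h x * dft e h (inverse (x * y)) = dft2 e A x y * dft e h (inverse y)"
proof -
  have "x \<noteq> 0" using assms(1) e_pos by (auto simp: power_0_left)
  hence "x * inverse (x * y) = inverse y" by simp
  hence "dft e h x * dft e h (inverse (x * y)) =
      dft e (\<lambda>i. dft e (\<lambda>a. h a * h (a + i)) (inverse y)) x"
    unfolding dft_mult_dft[OF periodic assms(1)] by (simp only:)
  also have "\<dots> = dft e (\<lambda>i. \<Sum>j<e. A $$ (i, j) * dft e (\<lambda>a. h (a + j)) (inverse y)) x"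
    by (intro dft_cong) (simp add: mult_shift dft_sum dft_cmult)
  also have "\<dots> = dft e (\<lambda>i. dft e (\<lambda>j. A $$ (i, j)) y * dft e h (inverse y)) x"
    using dft_shift_inverse[OF periodic assms(2) e_pos]
    by (simp add: dft_def[of e "\<lambda>j. A $$ (_, j)"] sum_distrib_right mult.assoc)
  finally show ?thesis by (simp only: dft2_def dft_cmult_right)
qed

lemma det_shift_matrix_nonzero:
  assumes "\<And>z. z ^ e = 1 \<Longrightarrow> dft e h z \<noteq> 0"
  shows "det (mat e e (\<lambda>(j, a). h (a + j))) \<noteq> 0"
proof
  let ?V = "mat e e (\<lambda>(j, a). h (a + j))"
  assume "det ?V = 0"
  then obtain v where v: "v \<in> carrier_vec e" "v \<noteq> 0\<^sub>v e" "?V *\<^sub>v v = 0\<^sub>v e"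
    using det_0_iff_vec_prod_zero_field[of ?V e] by auto
  have row: "(\<Sum>a<e. v $ a * h (j + a)) = 0" if "j < e" for j
  proof -
    have "(?V *\<^sub>v v) $ j = (\<Sum>a<e. v $ a * h (j + a))"
      using v(1) that by (simp add: scalar_prod_def lessThan_atLeast0 mult.commute add.commute)
    thus ?thesis using v(3) that by simp
  qed
  have dft_v: "dft e (\<lambda>a. v $ a) z = 0" if z: "z ^ e = 1" for z
  proof -
    have "dft e (\<lambda>j. \<Sum>a<e. v $ a * h (j + a)) (inverse z) = dft e (\<lambda>_. 0) (inverse z)"
      using row by (rule dft_cong)
    hence "dft e (\<lambda>a. v $ a) z * dft e h (inverse z) = 0"
      using dft_shift_inverse[OF periodic z e_pos]
      by (simp add: dft_sum dft_cmult dft_def[of e "($) v"] dft_def[of e "\<lambda>_. 0"]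
          sum_distrib_right mult.assoc)
    thus ?thesis using assms[of "inverse z"] z by (simp add: power_inverse)
  qed
  have "v $ a = 0" if "a < e" for a
    by (rule dft_eq_0_imp[OF card_roots_of_unity dft_v that])
  hence "v = 0\<^sub>v e" using v(1) by (intro eq_vecI) auto
  thus False using v(2) by simp
qed

end

lemma char_poly_mat_diag: "char_poly (mat_diag n d) = (\<Prod>i<n. [:- d i, 1:])"
proof -
  have "char_poly (mat_diag n d) = (\<Prod>a\<leftarrow>diag_mat (mat_diag n d). [:- a, 1:])"
    by (intro char_poly_upper_triangular[of _ n]) (auto simp: upper_triangular_def mat_diag_def)
  also have "diag_mat (mat_diag n d) = map d [0..<n]"
    by (auto simp: diag_mat_def mat_diag_def intro!: map_cong)
  finally show ?thesis
    using prod.distinct_set_conv_list[of "[0..<n]" "\<lambda>i. [:- d i, 1:]"]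
    by (simp add: o_def atLeast0LessThan)
qed

lemma char_poly_eq_if_diagonalized:
  fixes A V :: "'a::field mat"
  assumes A: "A \<in> carrier_mat n n" and V: "V \<in> carrier_mat n n" and "det V \<noteq> 0"
    and AV: "A * V = V * mat_diag n d"
  shows "char_poly A = (\<Prod>i<n. [:- d i, 1:])"
proof -
  from det_non_zero_imp_unit[OF V assms(3), unfolded Units_def, of "()"]
  obtain W where W: "W \<in> carrier_mat n n" "V * W = 1\<^sub>m n" "W * V = 1\<^sub>m n"
    by (auto simp: ring_mat_def)
  have "A = A * (V * W)" using A W by simp
  also have "\<dots> = V * mat_diag n d * W" using assoc_mult_mat[OF A V W(1)] AV by simp
  finally have "similar_mat_wit A (mat_diag n d) V W"
    using A V W by (intro similar_mat_witI[of _ _ n]) auto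
  hence "similar_mat A (mat_diag n d)" unfolding similar_mat_def by blast
  thus ?thesis using char_poly_mat_diag by (metis char_poly_similar)
qed

lemma (in multiplication_matrix) char_poly_eq:
  assumes "\<And>z. z ^ e = 1 \<Longrightarrow> dft e h z \<noteq> 0"
  shows "char_poly A = (\<Prod>i<e. [:- h i, 1:])"
proof (rule char_poly_eq_if_diagonalized)
  let ?V = "mat e e (\<lambda>(j, a). h (a + j))"
  show "A * ?V = ?V * mat_diag e h"
  proof (rule eq_matI)
    fix i a assume "i < dim_row (?V * mat_diag e h)" "a < dim_col (?V * mat_diag e h)"
    hence ia: "i < e" "a < e" by (auto simp: mat_diag_def)
    have "(A * ?V) $$ (i, a) = (\<Sum>j<e. A $$ (i, j) * h (a + j))"
      using ia carrier by (simp add: scalar_prod_def lessThan_atLeast0)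
    also have "\<dots> = h (a + i) * h a" using mult_shift[OF ia(1), of a] by (simp add: mult.commute)
    also have "\<dots> = (?V * mat_diag e h) $$ (i, a)"
      using ia by (simp add: mat_diag_mult_right[of _ e])
    finally show "(A * ?V) $$ (i, a) = (?V * mat_diag e h) $$ (i, a)" .
  qed (use carrier in \<open>auto simp: mat_diag_def\<close>)
qed (use carrier det_shift_matrix_nonzero[OF assms] in auto)

lemma multiplication_matrix_eq_comp_power:
  fixes A B :: "'a::field mat"
  assumes "multiplication_matrix e g A" "multiplication_matrix e h B" "n \<ge> 1"
    and nonzero: "\<And>z. z ^ e = 1 \<Longrightarrow> dft e h z \<noteq> 0"
    and lift: "\<And>z. z ^ e = 1 \<Longrightarrow> dft e h z = c * dft e g z ^ n"
  shows "B = c \<cdot>\<^sub>m comp_power e A n"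
proof -
  interpret A: multiplication_matrix e g A by fact
  interpret B: multiplication_matrix e h B by fact
  show ?thesis
  proof (rule mat_eqI_dft2[OF A.card_roots_of_unity])
    fix x y :: 'a assume xy: "x ^ e = 1" "y ^ e = 1"
    hence roots: "inverse y ^ e = 1" "inverse (x * y) ^ e = 1"
      by (simp_all add: power_inverse power_mult_distrib)
    have "dft2 e B x y * dft e h (inverse y) = dft e h x * dft e h (inverse (x * y))"
      using B.dft_mult_dft_inverse[OF xy] ..
    also have "\<dots> = c * (c * (dft e g x * dft e g (inverse (x * y))) ^ n)"
      unfolding lift[OF xy(1)] lift[OF roots(2)] power_mult_distrib by (simp only: mult_ac)
    also have "\<dots> = c * dft2 e A x y ^ n * dft e h (inverse y)"
      unfolding A.dft_mult_dft_inverse[OF xy] by (simp add: lift[OF roots(1)] power_mult_distrib)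
    finally have "dft2 e B x y = c * dft2 e A x y ^ n"
      using nonzero[OF roots(1)] by simp
    thus "dft2 e B x y = dft2 e (c \<cdot>\<^sub>m comp_power e A n) x y"
      using dft2_smult[OF comp_power_carrier[OF A.carrier]] dft2_comp_power[OF xy assms(3)] by simp
  qed (use B.carrier comp_power_carrier[OF A.carrier, of n] in auto)
qed

section \<open>The canonical additive character of a finite field\<close>

text \<open>The library states this for the class \<open>finite_field\<close>, which the sort \<open>{finite,field}\<close> does not
  imply.\<close>

lemma finite_field_power_card:
  fixes x :: "'K::{finite,field}"
  shows "x ^ card (UNIV :: 'K set) = x"
proof (cases "x = 0")
  case False
  have "(\<Prod>y\<in>UNIV - {0}. y) = (\<Prod>y\<in>UNIV - {0}. x * y)"
    by (rule prod.reindex_bij_witness[of _ "\<lambda>y. x * y" "\<lambda>y. y / x"]) (use False in auto)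
  also have "\<dots> = x ^ card (UNIV - {0::'K}) * (\<Prod>y\<in>UNIV - {0}. y)"
    by (simp add: prod.distrib)
  finally have "x ^ Suc (card (UNIV - {0::'K})) = x" by simp
  also have "Suc (card (UNIV - {0::'K})) = card (UNIV :: 'K set)"
    by (rule card.remove[symmetric]) auto
  finally show ?thesis .
qed (simp add: finite_UNIV_card_ge_0)

lemma CHAR_eq_of_card_prime_power:
  assumes "prime p" "card (UNIV :: 'K::{finite,field} set) = p ^ k"
  shows "CHAR('K) = p"
proof -
  have "prime CHAR('K)"
    using prime_CHAR_semidom[where ?'a = 'K] finite_imp_CHAR_pos[where ?'a = 'K] by simp
  moreover have "CHAR('K) dvd p ^ k" using CHAR_dvd_CARD[where ?'a = 'K] assms by simp
  ultimately show ?thesis using assms(1) by (meson prime_dvd_power primes_dvd_imp_eq)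
qed

lemma power_power_eq_self:
  fixes x :: "'a::monoid_mult"
  shows "x ^ q = x \<Longrightarrow> x ^ (q ^ k) = x"
  by (induction k) (simp_all add: power_mult)

lemma funpow_power: "((\<lambda>x::'a::monoid_mult. x ^ q) ^^ i) x = x ^ (q ^ i)"
  by (induction i) (simp_all add: mult.commute flip: power_mult)

lemma cis_mod:
  assumes "p > 0"
  shows "cis (2 * pi * real (j mod p) / real p) = cis (2 * pi * real j / real p)"
proof -
  have "real j = real p * real (j div p) + real (j mod p)"
    by (metis mult_div_mod_eq of_nat_add of_nat_mult)
  hence "2 * pi * real j / real p = 2 * pi * real (j mod p) / real p + 2 * pi * real (j div p)"
    using assms by (simp add: field_simps)
  thus ?thesis by (simp add: cis_mult[symmetric] cis_multiple_2pi)
qed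

lemma cis_eq_1_iff_less:
  assumes "j < p"
  shows "cis (2 * pi * real j / real p) = 1 \<longleftrightarrow> j = 0"
proof -
  have "inj_on (\<lambda>k. cis (2 * pi * real k / real p)) {..<p}"
    using assms bij_betw_roots_unity[of p] by (auto simp: bij_betw_def)
  from inj_on_eq_iff[OF this, of j 0] show ?thesis using assms by simp
qed

locale finite_subfield =
  fixes p m d :: nat and field_type :: "'K::{finite,field} itself"
  assumes prime_p: "prime p"
    and card_UNIV: "card (UNIV :: 'K set) = p ^ d"
    and m_dvd_d: "m dvd d"
begin

abbreviation F :: "'K set" where "F \<equiv> subfield_pm p m"

lemma CHAR_eq: "CHAR('K) = p"
  using prime_p card_UNIV by (rule CHAR_eq_of_card_prime_power)

lemma p_ge_2: "p \<ge> 2"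
  by (rule prime_ge_2_nat[OF prime_p])

lemma d_pos: "d > 0"
proof (rule ccontr)
  assume "\<not> d > 0"
  hence "card (UNIV :: 'K set) = 1" using card_UNIV by simp
  hence "(0::'K) = 1" by (metis UNIV_I card_1_singletonE singletonD)
  thus False by simp
qed

lemma m_pos: "m > 0"
  using m_dvd_d d_pos by (auto intro: Nat.gr0I)

lemma p_power_ge_2: "k > 0 \<Longrightarrow> p ^ k \<ge> 2"
  using power_increasing[of 1 k p] p_ge_2 by simp

lemma power_p_add: "(x + y :: 'K) ^ (p ^ k) = x ^ (p ^ k) + y ^ (p ^ k)"
  by (rule freshmans_dream') (use prime_p CHAR_eq in auto)

lemma power_p_sum: "sum g A ^ (p ^ k) = (\<Sum>i\<in>A. (g i :: 'K) ^ (p ^ k))"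
  by (rule freshmans_dream_sum') (use prime_p CHAR_eq in auto)

lemma subfield_closed: "0 \<in> F" "1 \<in> F" "x \<in> F \<Longrightarrow> y \<in> F \<Longrightarrow> x + y \<in> F"
  using p_ge_2 by (auto simp: subfield_pm_def power_p_add power_0_left)

lemma minus_one_in_subfield: "- 1 \<in> F"
proof -
  have "(-1 :: 'K) ^ (p ^ m) + 1 ^ (p ^ m) = 0"
    using power_p_add[of "-1" 1 m] p_ge_2 by (simp add: power_0_left)
  thus ?thesis by (simp add: subfield_pm_def eq_neg_iff_add_eq_0)
qed

lemma alg_closure_power_eq_self: "{x :: 'K alg_closure. x ^ (p ^ m) = x} = to_ac ` F"
proof -
  have "{x :: 'K alg_closure. x ^ (p ^ d) = x} = range to_ac"
  proof (rule card_seteq[symmetric])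
    show "range to_ac \<subseteq> {x :: 'K alg_closure. x ^ (p ^ d) = x}"
      using finite_field_power_card[where ?'K = 'K] card_UNIV by (auto simp flip: to_ac_power)
    show "card {x :: 'K alg_closure. x ^ (p ^ d) = x} \<le> card (range (to_ac :: 'K \<Rightarrow> _))"
      using card_power_eq_self_le[OF p_power_ge_2[OF d_pos]]
      by (simp add: card_image inj_to_ac card_UNIV)
  qed (rule finite_power_eq_self[OF p_power_ge_2[OF d_pos]])
  moreover have "x ^ (p ^ d) = x" if "x ^ (p ^ m) = x" for x :: "'K alg_closure"
  proof -
    obtain k where "d = m * k" using m_dvd_d by (rule dvdE)
    thus ?thesis using power_power_eq_self[OF that, of k] by (simp add: power_mult)
  qed
  ultimately have "{x :: 'K alg_closure. x ^ (p ^ m) = x} \<subseteq> range to_ac" by blast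
  thus ?thesis by (auto simp: subfield_pm_def simp flip: to_ac_power)
qed

lemma card_subfield: "card F = p ^ m"
proof -
  have "card F = card {x :: 'K alg_closure. x ^ (p ^ m) = x}"
    unfolding alg_closure_power_eq_self
    by (rule card_image[symmetric]) (rule inj_on_subset[OF inj_to_ac subset_UNIV])
  also have "\<dots> = p ^ m"
    using m_pos
    by (intro card_power_eq_self_alg_closed p_power_ge_2)
      (simp_all add: of_nat_eq_0_iff_char_dvd CHAR_eq)
  finally show ?thesis .
qed

lemma power_map_alg_closure: "finite_fixpoints_endomorphism (\<lambda>x :: 'K alg_closure. x ^ (p ^ m))"
proof
  show "finite {x :: 'K alg_closure. ((\<lambda>x. x ^ (p ^ m)) ^^ i) x = x}" if "i > 0" for i
    unfolding funpow_power power_mult[symmetric]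
    using that m_pos by (intro finite_power_eq_self p_power_ge_2) simp
  show "(x + y) ^ (p ^ m) = x ^ (p ^ m) + y ^ (p ^ m)" for x y :: "'K alg_closure"
    by (rule freshmans_dream') (use CHAR_eq prime_p in auto)
qed (use p_ge_2 in \<open>simp_all add: power_mult_distrib\<close>)

definition zp_char :: "'K \<Rightarrow> complex" where
  "zp_char y = cis (2 * pi * real (to_Zp p y) / real p)"

lemma of_nat_eq_iff_mod: "(of_nat a :: 'K) = of_nat b \<longleftrightarrow> a mod p = b mod p"
  by (simp add: of_nat_eq_iff_cong_CHAR CHAR_eq cong_def)

lemma power_p_eq_self_imp_of_nat:
  assumes "(y::'K) ^ p = y"
  obtains j where "j < p" "y = of_nat j"
proof -
  have "of_nat ` {..<p} = {y::'K. y ^ p = y}"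
  proof (rule card_seteq)
    show "of_nat ` {..<p} \<subseteq> {y::'K. y ^ p = y}"
    proof safe
      fix j show "(of_nat j :: 'K) ^ p = of_nat j"
        using power_p_sum[of "\<lambda>_. 1" "{..<j}" 1] by simp
    qed
    have "inj_on (of_nat :: nat \<Rightarrow> 'K) {..<p}" by (simp add: inj_on_def of_nat_eq_iff_mod)
    thus "card {y::'K. y ^ p = y} \<le> card ((of_nat :: nat \<Rightarrow> 'K) ` {..<p})"
      using card_power_eq_self_le[OF p_ge_2] by (simp add: card_image)
  qed simp
  with assms that show ?thesis by blast
qed

lemma zp_char_of_nat: "zp_char (of_nat j) = cis (2 * pi * real j / real p)"
proof -
  have "to_Zp p (of_nat j :: 'K) = j mod p"
    unfolding to_Zp_def of_nat_eq_iff_mod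
    by (rule the_equality) (use p_ge_2 in auto)
  thus ?thesis using cis_mod[of p j] p_ge_2 by (simp add: zp_char_def)
qed

lemma zp_char_add:
  assumes "x ^ p = x" "y ^ p = y"
  shows "zp_char (x + y) = zp_char x * zp_char y"
proof -
  obtain a b where ab: "x = of_nat a" "y = of_nat b"
    using assms by (metis power_p_eq_self_imp_of_nat)
  hence "zp_char (x + y) = cis (2 * pi * real (a + b) / real p)"
    by (simp only: zp_char_of_nat flip: of_nat_add)
  thus ?thesis by (simp add: ab zp_char_of_nat cis_mult add_divide_distrib ring_distribs)
qed

lemma zp_char_eq_1_iff:
  assumes "y ^ p = y"
  shows "zp_char y = 1 \<longleftrightarrow> y = 0"
proof -
  obtain j where "j < p" "y = of_nat j" using assms by (rule power_p_eq_self_imp_of_nat)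
  thus ?thesis
    using of_nat_eq_iff_mod[of j 0] by (simp add: zp_char_of_nat cis_eq_1_iff_less)
qed

abbreviation Tr :: "'K \<Rightarrow> 'K" where "Tr \<equiv> trace_pm p m"

lemma trace_add: "Tr (x + y) = Tr x + Tr y"
  by (simp add: trace_pm_def power_p_add sum.distrib)

lemma trace_power_p:
  assumes "x \<in> F"
  shows "Tr x ^ p = Tr x"
proof -
  have "x + Tr x ^ p = x + (\<Sum>k<m. x ^ (p ^ Suc k))"
    unfolding trace_pm_def using power_p_sum[of "\<lambda>k. x ^ (p ^ k)" "{..<m}" 1]
    by (simp add: mult.commute[of p] power_mult)
  also have "\<dots> = (\<Sum>k<Suc m. x ^ (p ^ k))" unfolding sum.lessThan_Suc_shift by simp
  also have "\<dots> = x + Tr x" using assms by (simp add: trace_pm_def subfield_pm_def)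
  finally show ?thesis by simp
qed

lemma ex_trace_nonzero: "\<exists>x\<in>F. Tr x \<noteq> 0"
proof (rule ccontr)
  assume no_trace: "\<not> (\<exists>x\<in>F. Tr x \<noteq> 0)"
  define P :: "'K poly" where "P = (\<Sum>k<m. monom 1 (p ^ k))"
  have inj: "p ^ k = p ^ l \<longleftrightarrow> k = l" for k l using p_ge_2 by (intro power_inject_exp) auto
  have "coeff P (p ^ (m - 1)) = 1"
    using m_pos by (simp add: P_def coeff_sum inj)
  hence P0: "P \<noteq> 0" by auto
  have "p ^ m \<le> card {x. poly P x = 0}"
    unfolding card_subfield[symmetric]
    using no_trace by (intro card_mono) (auto simp: P_def poly_sum poly_monom trace_pm_def)
  also have "\<dots> \<le> degree P" by (rule card_poly_roots_bound[OF P0])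
  also have "\<dots> \<le> p ^ (m - 1)"
    unfolding P_def using p_ge_2
    by (intro degree_sum_le order.trans[OF degree_monom_le] power_increasing) auto
  also have "\<dots> < p ^ m" using p_ge_2 m_pos by (intro power_strict_increasing) auto
  finally show False by simp
qed

definition \<psi> :: "'K \<Rightarrow> complex" where "\<psi> x = zp_char (Tr x)"

lemma psi_add: "x \<in> F \<Longrightarrow> y \<in> F \<Longrightarrow> \<psi> (x + y) = \<psi> x * \<psi> y"
  by (simp add: \<psi>_def trace_add zp_char_add trace_power_p)

lemma psi_0: "\<psi> 0 = 1"
  using zp_char_of_nat[of 0] p_ge_2 by (simp add: \<psi>_def trace_pm_def power_0_left)

lemma psi_nontrivial: "\<exists>c\<in>F. \<psi> c \<noteq> 1"
  using ex_trace_nonzero by (auto simp: \<psi>_def zp_char_eq_1_iff trace_power_p)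

lemma sum_psi: "(\<Sum>x\<in>F. \<psi> x) = 0"
proof -
  obtain c where c: "c \<in> F" "\<psi> c \<noteq> 1" using psi_nontrivial by blast
  have inj: "inj_on (\<lambda>x. x + c) F" by (auto simp: inj_on_def)
  have "(\<lambda>x. x + c) ` F \<subseteq> F" by (intro image_subsetI subfield_closed(3) c)
  hence "bij_betw (\<lambda>x. x + c) F F"
    using inj endo_inj_surj[OF finite _ inj] by (auto simp: bij_betw_def)
  hence "(\<Sum>x\<in>F. \<psi> x) = (\<Sum>x\<in>F. \<psi> (x + c))" by (rule sum.reindex_bij_betw[symmetric])
  also have "\<dots> = \<psi> c * (\<Sum>x\<in>F. \<psi> x)"
    using c by (simp add: psi_add sum_distrib_left mult.commute)
  finally show ?thesis using c by simp
qed

end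

section \<open>Gaussian periods and cyclotomic numbers\<close>

locale gaussian_periods = finite_subfield p m d "TYPE('K)"
  for p m d :: nat and e :: nat and \<beta> :: "'K::{finite,field}" +
  assumes e_pos: "e > 0"
    and e_dvd: "e dvd p ^ m - 1"
    and gen: "is_generator p m \<beta>"
begin

abbreviation f :: nat where "f \<equiv> f_of p m e"
abbreviation \<eta> :: "nat \<Rightarrow> complex" where "\<eta> \<equiv> gauss_period p m e \<beta>"

lemma e_times_f: "e * f = p ^ m - 1"
  using e_dvd by (simp add: f_of_def)

lemma e_times_f_pos: "e * f > 0"
  unfolding e_times_f using p_power_ge_2[OF m_pos] by simp

lemma gen_powers: "range (\<lambda>k. \<beta> ^ k) = F - {0}"
  using gen by (simp add: is_generator_def)

lemma gen_power_in: "\<beta> ^ k \<in> F - {0}"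
  unfolding gen_powers[symmetric] by simp

lemma one_plus_gen_power_in: "1 + \<beta> ^ k \<in> F"
  using subfield_closed(3)[OF subfield_closed(2)] gen_power_in by blast

lemma gen_nonzero: "\<beta> \<noteq> 0"
  using gen_power_in[of 1] by simp

lemma periodic_gen_power: "periodic (e * f) (\<lambda>k. \<beta> ^ k)"
proof -
  have "\<beta> * \<beta> ^ (p ^ m - 1) = \<beta> ^ (p ^ m)"
    using p_power_ge_2[OF m_pos] by (cases "p ^ m") auto
  also have "\<dots> = \<beta> * 1" using gen_power_in[of 1] by (simp add: subfield_pm_def)
  finally have "\<beta> ^ (e * f) = 1" unfolding e_times_f using gen_nonzero by simp
  thus ?thesis by (simp add: periodic_def power_add)
qed

lemma bij_gen_powers: "bij_betw (\<lambda>k. \<beta> ^ k) {..<e * f} (F - {0})"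
proof -
  have "(\<lambda>k. \<beta> ^ k) ` {..<e * f} = F - {0}"
  proof
    show "F - {0} \<subseteq> (\<lambda>k. \<beta> ^ k) ` {..<e * f}"
    proof
      fix x assume "x \<in> F - {0}"
      then obtain k where "x = \<beta> ^ k" unfolding gen_powers[symmetric] by auto
      hence "x = \<beta> ^ (k mod (e * f))" by (simp only: periodic_mod[OF periodic_gen_power])
      thus "x \<in> (\<lambda>k. \<beta> ^ k) ` {..<e * f}" using e_times_f_pos by (intro image_eqI) auto
    qed
  qed (auto simp flip: gen_powers)
  moreover have "card (F - {0}) = e * f"
    using subfield_closed(1) by (simp add: card_Diff_singleton card_subfield e_times_f)
  ultimately show ?thesis
    unfolding bij_betw_def by (auto intro!: eq_card_imp_inj_on)
qed

definition dlog :: "'K \<Rightarrow> nat" where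
  "dlog = the_inv_into {..<e * f} (\<lambda>k. \<beta> ^ k)"

lemma dlog_less: "x \<in> F - {0} \<Longrightarrow> dlog x < e * f"
  and gen_power_dlog: "x \<in> F - {0} \<Longrightarrow> \<beta> ^ dlog x = x"
  using bij_gen_powers the_inv_into_into[of "\<lambda>k. \<beta> ^ k" "{..<e * f}" x "{..<e * f}"]
  by (auto simp: dlog_def bij_betw_def f_the_inv_into_f)

lemma dlog_gen_power: "dlog (\<beta> ^ k) = k mod (e * f)"
proof -
  have "dlog (\<beta> ^ (k mod (e * f))) = k mod (e * f)"
    unfolding dlog_def using bij_gen_powers e_times_f_pos
    by (intro the_inv_into_f_f) (auto simp: bij_betw_def)
  thus ?thesis by (simp only: periodic_mod[OF periodic_gen_power])
qed

lemma dlog_gen_power_less: "k < e * f \<Longrightarrow> dlog (\<beta> ^ k) = k"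
  by (simp add: dlog_gen_power)

lemma dlog_gen_power_mod: "dlog (\<beta> ^ k) mod e = k mod e"
  by (simp add: dlog_gen_power mod_mod_cancel)

lemma period_eq: "\<eta> i = (\<Sum>j<f. \<psi> (\<beta> ^ (e * j + i)))"
  by (simp add: gauss_period_def \<psi>_def zp_char_def)

lemma sum_coset_shift:
  "(\<Sum>j<f. h (\<beta> ^ (e * (j + w) + i)) :: complex) = (\<Sum>j<f. h (\<beta> ^ (e * j + i)))"
proof (rule sum_periodic_shift)
  have "e * (j + f) + i = (e * j + i) + e * f" for j by (simp add: algebra_simps)
  thus "periodic f (\<lambda>j. h (\<beta> ^ (e * j + i)))"
    using periodic_gen_power unfolding periodic_def by metis
qed

lemma period_periodic: "periodic e \<eta>"
proof -
  have "\<eta> (i + e) = (\<Sum>j<f. \<psi> (\<beta> ^ (e * (j + 1) + i)))" for i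
    unfolding period_eq by (simp add: algebra_simps)
  thus ?thesis unfolding periodic_def sum_coset_shift period_eq by simp
qed

lemma sum_psi_coset_mult:
  assumes "x \<in> F - {0}"
  shows "(\<Sum>u<f. \<psi> (\<beta> ^ (e * u + a) * x)) = \<eta> (a + dlog x mod e)"
proof -
  have "\<beta> ^ (e * u + a) * x = \<beta> ^ (e * (u + dlog x div e) + (a + dlog x mod e))" for u
  proof -
    have "\<beta> ^ (e * u + a) * x = \<beta> ^ ((e * u + a) + dlog x)"
      unfolding power_add[of _ "e * u + a"] gen_power_dlog[OF assms] ..
    also have "(e * u + a) + dlog x = e * (u + dlog x div e) + (a + dlog x mod e)"
      by (simp add: algebra_simps)
    finally show ?thesis .
  qed
  thus ?thesis unfolding period_eq by (simp only: sum_coset_shift)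
qed

lemma coset_index_set:
  assumes "x \<in> F - {0}" "j < e"
  shows "{w. w < f \<and> x = \<beta> ^ (e * w + j)} = (if j = dlog x mod e then {dlog x div e} else {})"
proof -
  have "w < f \<and> x = \<beta> ^ (e * w + j) \<longleftrightarrow> w = dlog x div e \<and> j = dlog x mod e" for w
  proof
    assume w: "w < f \<and> x = \<beta> ^ (e * w + j)"
    have "e * w + j < e * Suc w" using assms(2) by simp
    also have "\<dots> \<le> e * f" using w by (intro mult_le_mono2) simp
    finally have "dlog x = e * w + j" using w by (simp add: dlog_gen_power_less)
    thus "w = dlog x div e \<and> j = dlog x mod e" using assms(2) by simp
  next
    assume "w = dlog x div e \<and> j = dlog x mod e"
    thus "w < f \<and> x = \<beta> ^ (e * w + j)"
      using dlog_less[OF assms(1)] gen_power_dlog[OF assms(1)]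
      by (simp add: less_mult_imp_div_less mult.commute)
  qed
  thus ?thesis by auto
qed

lemma sum_cyc_num:
  fixes g :: "nat \<Rightarrow> complex"
  shows "(\<Sum>j<e. of_nat (cyc_num p m e \<beta> i j) * g j) =
    (\<Sum>v | v < f \<and> 1 + \<beta> ^ (e * v + i) \<noteq> 0. g (dlog (1 + \<beta> ^ (e * v + i)) mod e))"
proof -
  define x where "x v = 1 + \<beta> ^ (e * v + i)" for v
  have x_in: "x v \<in> F" for v unfolding x_def by (rule one_plus_gen_power_in)
  have "cyc_num p m e \<beta> i j = (\<Sum>v | v < f \<and> x v \<noteq> 0. if j = dlog (x v) mod e then 1 else 0)"
    if "j < e" for j
  proof -
    have "cyc_num p m e \<beta> i j = card (SIGMA v:{..<f}. {w. w < f \<and> x v = \<beta> ^ (e * w + j)})"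
      unfolding cyc_num_def x_def by (rule arg_cong[of _ _ card]) auto
    also have "\<dots> = (\<Sum>v<f. card {w. w < f \<and> x v = \<beta> ^ (e * w + j)})" by simp
    also have "\<dots> = (\<Sum>v | v < f \<and> x v \<noteq> 0. card {w. w < f \<and> x v = \<beta> ^ (e * w + j)})"
      using gen_nonzero by (intro sum.mono_neutral_right) auto
    also have "\<dots> = (\<Sum>v | v < f \<and> x v \<noteq> 0. if j = dlog (x v) mod e then 1 else 0)"
      using that x_in by (intro sum.cong refl) (simp add: coset_index_set)
    finally show ?thesis .
  qed
  hence "(\<Sum>j<e. of_nat (cyc_num p m e \<beta> i j) * g j) =
      (\<Sum>j<e. \<Sum>v | v < f \<and> x v \<noteq> 0. if j = dlog (x v) mod e then g j else 0)"
    by (auto simp: sum_distrib_right intro!: sum.cong)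
  also have "\<dots> = (\<Sum>v | v < f \<and> x v \<noteq> 0. g (dlog (x v) mod e))"
    using e_pos by (subst sum.swap) simp
  finally show ?thesis unfolding x_def .
qed

lemma D_ind_eq:
  assumes "i < e"
  shows "D_ind p m e \<beta> i = (if i = dlog (-1) mod e then 1 else 0)"
proof -
  have "(\<exists>x \<in> F - {0}. - 1 = \<beta> ^ i * x ^ e) \<longleftrightarrow> i = dlog (-1) mod e"
  proof
    assume "\<exists>x \<in> F - {0}. - 1 = \<beta> ^ i * x ^ e"
    then obtain k where "- 1 = \<beta> ^ i * (\<beta> ^ k) ^ e" unfolding gen_powers[symmetric] by auto
    hence "- 1 = \<beta> ^ (i + k * e)" by (simp add: power_add power_mult)
    thus "i = dlog (-1) mod e" using assms by (simp add: dlog_gen_power_mod)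
  next
    assume "i = dlog (-1) mod e"
    hence "\<beta> ^ i * (\<beta> ^ (dlog (-1) div e)) ^ e = \<beta> ^ dlog (-1)"
      by (simp flip: power_mult power_add)
    also have "\<dots> = -1" using gen_power_dlog[of "-1"] minus_one_in_subfield by simp
    finally have "- 1 = \<beta> ^ i * (\<beta> ^ (dlog (-1) div e)) ^ e" ..
    thus "\<exists>x \<in> F - {0}. - 1 = \<beta> ^ i * x ^ e" using gen_power_in by blast
  qed
  thus ?thesis by (simp add: D_ind_def)
qed

lemma card_one_plus_coset_eq_0:
  assumes "i < e"
  shows "of_nat (card {v. v < f \<and> 1 + \<beta> ^ (e * v + i) = 0}) =
    (of_int (D_ind p m e \<beta> i) :: 'a::ring_1)"
proof -
  have "{v. v < f \<and> 1 + \<beta> ^ (e * v + i) = 0} = {v. v < f \<and> - 1 = \<beta> ^ (e * v + i)}"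
    by (auto simp: neg_eq_iff_add_eq_0)
  thus ?thesis
    using assms minus_one_in_subfield by (simp add: coset_index_set D_ind_eq)
qed

lemma period_mult_cyc_num:
  assumes "i < e"
  shows "\<eta> a * \<eta> (a + i) = of_nat f * of_int (D_ind p m e \<beta> i) +
    (\<Sum>j<e. of_nat (cyc_num p m e \<beta> i j) * \<eta> (a + j))"
proof -
  define x where "x v = 1 + \<beta> ^ (e * v + i)" for v
  have x_in: "x v \<in> F" for v unfolding x_def by (rule one_plus_gen_power_in)
  have psi_split: "\<psi> (\<beta> ^ (e * u + a)) * \<psi> (\<beta> ^ (e * (v + u) + (a + i))) =
      \<psi> (\<beta> ^ (e * u + a) * x v)" for u v
  proof -
    have "\<beta> ^ (e * u + a) * x v = \<beta> ^ (e * u + a) + \<beta> ^ (e * (v + u) + (a + i))"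
      by (simp add: x_def algebra_simps power_add)
    thus ?thesis using gen_power_in psi_add by auto
  qed
  have "\<eta> a * \<eta> (a + i) = (\<Sum>u<f. \<psi> (\<beta> ^ (e * u + a)) * (\<Sum>v<f. \<psi> (\<beta> ^ (e * (v + u) + (a + i)))))"
    unfolding sum_coset_shift by (simp add: period_eq sum_distrib_right)
  also have "\<dots> = (\<Sum>u<f. \<Sum>v<f. \<psi> (\<beta> ^ (e * u + a) * x v))"
    unfolding sum_distrib_left psi_split ..
  also have "\<dots> = (\<Sum>v<f. \<Sum>u<f. \<psi> (\<beta> ^ (e * u + a) * x v))" by (rule sum.swap)
  also have "\<dots> = (\<Sum>v | v < f \<and> x v = 0. of_nat f) +
      (\<Sum>v | v < f \<and> x v \<noteq> 0. \<eta> (a + dlog (x v) mod e))"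
    using x_in sum.Int_Diff[of "{..<f}" "\<lambda>v. \<Sum>u<f. \<psi> (\<beta> ^ (e * u + a) * x v)" "{v. x v = 0}"]
    by (simp add: Int_def Diff_eq psi_0 sum_psi_coset_mult)
  also have "(\<Sum>v | v < f \<and> x v = 0. of_nat f) = (of_nat f * of_int (D_ind p m e \<beta> i) :: complex)"
    using card_one_plus_coset_eq_0[OF assms, where ?'a = complex] unfolding x_def by simp
  finally show ?thesis unfolding x_def sum_cyc_num[of i "\<lambda>j. \<eta> (a + j)"] .
qed

definition \<chi> :: "complex \<Rightarrow> 'K \<Rightarrow> complex" where
  "\<chi> z x = (if x = 0 then 0 else z ^ dlog x)"

lemma chi_gen_power:
  assumes "z ^ e = 1"
  shows "\<chi> z (\<beta> ^ k) = z ^ k"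
proof -
  have "periodic e (\<lambda>k. z ^ k)" using assms by (simp add: periodic_def power_add)
  hence "z ^ dlog (\<beta> ^ k) = z ^ k" using dlog_gen_power_mod[of k] by (metis periodic_mod)
  thus ?thesis using gen_nonzero by (simp add: \<chi>_def)
qed

lemma chi_mult:
  assumes "z ^ e = 1" "x \<in> F" "y \<in> F"
  shows "\<chi> z (x * y) = \<chi> z x * \<chi> z y"
proof (cases "x = 0 \<or> y = 0")
  case False
  then obtain a b where "x = \<beta> ^ a" "y = \<beta> ^ b"
    using assms gen_power_dlog by (metis DiffI singletonD)
  thus ?thesis using chi_gen_power[OF assms(1)] by (simp flip: power_add)
qed (auto simp: \<chi>_def)

lemma dft_period_eq_gauss_sum:
  assumes "z ^ e = 1"
  shows "dft e \<eta> z = (\<Sum>x\<in>F. \<chi> z x * \<psi> x)"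
proof -
  have "\<chi> z (\<beta> ^ (i + j * e)) = z ^ i" for i j
    using chi_gen_power[OF assms, of "i + e * j"] assms
    by (simp add: power_add power_mult mult.commute[of j])
  hence "dft e \<eta> z = (\<Sum>i<e. \<Sum>j<f. \<chi> z (\<beta> ^ (i + j * e)) * \<psi> (\<beta> ^ (i + j * e)))"
    by (simp add: dft_def period_eq sum_distrib_left mult.commute add.commute)
  also have "\<dots> = (\<Sum>j<f. \<Sum>i<e. \<chi> z (\<beta> ^ (i + j * e)) * \<psi> (\<beta> ^ (i + j * e)))" by (rule sum.swap)
  also have "\<dots> = (\<Sum>k<e * f. \<chi> z (\<beta> ^ k) * \<psi> (\<beta> ^ k))"
    using sum.nat_group_shift[of "\<lambda>k. \<chi> z (\<beta> ^ k) * \<psi> (\<beta> ^ k)" e f] by (simp add: mult.commute)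
  also have "\<dots> = (\<Sum>x\<in>F - {0}. \<chi> z x * \<psi> x)" by (rule sum.reindex_bij_betw[OF bij_gen_powers])
  also have "\<dots> = (\<Sum>x\<in>F. \<chi> z x * \<psi> x)"
    by (rule sum.mono_neutral_left) (auto simp: \<chi>_def)
  finally show ?thesis .
qed

lemma sum_periods: "(\<Sum>j<e. \<eta> (a + j)) = -1"
proof -
  have "(\<Sum>j<e. \<eta> (a + j)) = dft e \<eta> 1"
    using sum_periodic_shift[OF period_periodic, of a] by (simp add: dft_def add.commute)
  also have "\<dots> = (\<Sum>x\<in>F. \<chi> 1 x * \<psi> x)" by (rule dft_period_eq_gauss_sum) simp
  also have "\<dots> = (\<Sum>x\<in>F - {0}. \<psi> x)"
    by (rule sum.mono_neutral_cong_right) (auto simp: \<chi>_def)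
  also have "\<dots> = -1" using sum_psi subfield_closed(1) by (simp add: sum_diff1 psi_0)
  finally show ?thesis .
qed

abbreviation C :: "int mat" where "C \<equiv> mult_matrix p m e \<beta>"

lemma mult_matrix_carrier: "C \<in> carrier_mat e e"
  by (simp add: mult_matrix_def)

lemma period_mult:
  assumes "i < e"
  shows "\<eta> a * \<eta> (a + i) = (\<Sum>j<e. of_int (C $$ (i, j)) * \<eta> (a + j))"
proof -
  have "(\<Sum>j<e. of_int (C $$ (i, j)) * \<eta> (a + j)) =
      (\<Sum>j<e. of_nat (cyc_num p m e \<beta> i j) * \<eta> (a + j)) -
      of_int (D_ind p m e \<beta> i) * of_nat f * (\<Sum>j<e. \<eta> (a + j))"
    using assms by (simp add: mult_matrix_def sum_distrib_left algebra_simps sum_subtractf)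
  thus ?thesis using period_mult_cyc_num[OF assms] by (simp add: sum_periods)
qed

sublocale multiplication_matrix e \<eta> "map_mat of_int C :: complex mat"
proof
  show "\<eta> a * \<eta> (a + i) = (\<Sum>j<e. (map_mat of_int C :: complex mat) $$ (i, j) * \<eta> (a + j))"
    if "i < e" for a i
    using period_mult[OF that, of a] that mult_matrix_carrier by simp
qed (use e_pos card_roots_unity_eq[of e] period_periodic mult_matrix_carrier in auto)

lemma sum_mult_matrix_row:
  assumes "i < e"
  shows "(\<Sum>j<e. of_int (C $$ (i, j)) :: complex) =
    of_nat f - of_nat (p ^ m) * of_int (D_ind p m e \<beta> i)"
proof -
  let ?Z = "{v. v < f \<and> 1 + \<beta> ^ (e * v + i) = 0}"
  have Z: "?Z \<subseteq> {..<f}" by auto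
  have "{v. v < f \<and> 1 + \<beta> ^ (e * v + i) \<noteq> 0} = {..<f} - ?Z" by auto
  hence "(\<Sum>j<e. of_nat (cyc_num p m e \<beta> i j) :: complex) = of_nat (card ({..<f} - ?Z))"
    using sum_cyc_num[of i "\<lambda>_. 1"] by simp
  also have "\<dots> = of_nat f - of_nat (card ?Z)"
    using card_mono[OF _ Z] finite_subset[OF Z] by (simp add: card_Diff_subset[OF _ Z] of_nat_diff)
  also have "\<dots> = of_nat f - of_int (D_ind p m e \<beta> i)"
    unfolding card_one_plus_coset_eq_0[OF assms] ..
  finally have "(\<Sum>j<e. of_int (C $$ (i, j)) :: complex) =
      of_nat f - of_int (D_ind p m e \<beta> i) * (1 + of_nat (e * f))"
    using assms by (simp add: mult_matrix_def sum_subtractf algebra_simps)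
  thus ?thesis
    unfolding e_times_f using p_power_ge_2[OF m_pos] by (simp add: of_nat_diff mult.commute)
qed

lemma dft_period_mult_inverse:
  assumes "z ^ e = 1"
  shows "dft e \<eta> z * dft e \<eta> (inverse z) =
    of_nat (p ^ m) * z ^ (dlog (-1) mod e) - of_nat f * (\<Sum>i<e. z ^ i)"
proof -
  have "dft e \<eta> 1 = -1" using sum_periods[of 0] by (simp add: dft_def)
  hence "dft e \<eta> z * dft e \<eta> (inverse z) = - (\<Sum>i<e. (\<Sum>j<e. of_int (C $$ (i, j))) * z ^ i)"
    using dft_mult_dft_inverse[OF assms, of 1] mult_matrix_carrier by (simp add: dft2_def dft_def)
  also have "\<dots> =
      (\<Sum>i<e. of_nat (p ^ m) * (if i = dlog (-1) mod e then z ^ i else 0) - of_nat f * z ^ i)"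
    unfolding sum_negf[symmetric]
    by (intro sum.cong refl) (simp add: sum_mult_matrix_row D_ind_eq algebra_simps)
  also have "\<dots> = of_nat (p ^ m) * z ^ (dlog (-1) mod e) - of_nat f * (\<Sum>i<e. z ^ i)"
    using e_pos by (simp add: sum_subtractf flip: sum_distrib_left)
  finally show ?thesis .
qed

lemma dft_period_nonzero:
  assumes "z ^ e = 1"
  shows "dft e \<eta> z \<noteq> 0"
proof (cases "z = 1")
  case True
  thus ?thesis using sum_periods[of 0] by (simp add: dft_def)
next
  case False
  hence "dft e \<eta> z * dft e \<eta> (inverse z) = of_nat (p ^ m) * z ^ (dlog (-1) mod e)"
    using assms by (simp add: dft_period_mult_inverse sum_gp_strict)
  moreover have "z \<noteq> 0" using assms e_pos by (auto simp: power_0_left)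
  ultimately show ?thesis using p_ge_2 by auto
qed

lemma char_poly_mult_matrix: "char_poly (map_mat of_int C :: complex mat) = period_poly p m e \<beta>"
  using char_poly_eq[OF dft_period_nonzero] by (simp add: period_poly_def)

end

section \<open>Field extensions\<close>

lemma pred_dvd_power_pred: "q \<ge> 1 \<Longrightarrow> q - 1 dvd q ^ n - (1::nat)"
proof (induction n)
  case (Suc n)
  hence "q ^ Suc n - 1 = q * (q ^ n - 1) + (q - 1)"
    by (simp add: diff_mult_distrib2)
  moreover have "q - 1 dvd q * (q ^ n - 1) + (q - 1)"
    using Suc by (intro dvd_add dvd_mult) auto
  ultimately show ?case by (simp only:)
qed simp

lemma (in finite_subfield) trace_relative_trace:
  "trace_pm p r (\<Sum>i<n. x ^ ((p ^ r) ^ i)) = trace_pm p (n * r) (x :: 'K)"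
proof -
  have "trace_pm p r (\<Sum>i<n. x ^ ((p ^ r) ^ i)) = (\<Sum>k<r. \<Sum>i<n. x ^ (p ^ (k + i * r)))"
    unfolding trace_pm_def power_p_sum by (simp add: power_add mult.commute flip: power_mult)
  also have "\<dots> = (\<Sum>i<n. \<Sum>k<r. x ^ (p ^ (k + i * r)))" by (rule sum.swap)
  also have "\<dots> = trace_pm p (n * r) x"
    unfolding trace_pm_def by (rule sum.nat_group_shift)
  finally show ?thesis .
qed

locale gaussian_periods_extension =
  R: gaussian_periods p r "n * r" e gam + N: gaussian_periods p "n * r" "n * r" e lam
  for p r n e :: nat and gam lam :: "'K::{finite,field}" +
  assumes n_pos: "n \<ge> 1"
    and norm_gen: "\<exists>y \<in> subfield_pm p r - {0}. norm_rel p r n lam * inverse gam = y ^ e"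
begin

lemma full_subfield: "N.F = UNIV"
  using finite_field_power_card[where ?'K = 'K] R.card_UNIV by (auto simp: subfield_pm_def)

lemma chi_norm_gen_power:
  assumes "z ^ e = 1"
  shows "R.\<chi> z (norm_rel p r n (lam ^ k)) = z ^ k"
proof -
  obtain t where t: "norm_rel p r n lam * inverse gam = (gam ^ t) ^ e"
    using norm_gen unfolding R.gen_powers[symmetric] by auto
  have "norm_rel p r n lam = (norm_rel p r n lam * inverse gam) * gam" using R.gen_nonzero by simp
  also have "\<dots> = gam ^ (t * e + 1)" unfolding t by (simp flip: power_mult)
  finally have norm_lam: "norm_rel p r n lam = gam ^ (t * e + 1)" .
  have "norm_rel p r n (lam ^ k) = norm_rel p r n lam ^ k"
    by (simp add: norm_rel_def prod_power_distrib mult.commute flip: power_mult)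
  also have "\<dots> = gam ^ ((t * e + 1) * k)" unfolding norm_lam by (simp only: power_mult)
  finally have "R.\<chi> z (norm_rel p r n (lam ^ k)) = z ^ ((t * e + 1) * k)"
    using R.chi_gen_power[OF assms] by simp
  also have "(t * e + 1) * k = e * (t * k) + k" by (simp add: algebra_simps)
  finally show ?thesis by (simp add: power_add power_mult assms)
qed

lemma chi_norm:
  assumes "z ^ e = 1"
  shows "N.\<chi> z x = R.\<chi> z (norm_rel p r n x)"
proof (cases "x = 0")
  case True
  have "norm_rel p r n (0::'K) = 0"
    using n_pos R.p_ge_2 by (auto simp: norm_rel_def power_0_left)
  with True show ?thesis by (simp add: N.\<chi>_def R.\<chi>_def)
next
  case False
  hence "x \<in> N.F - {0}" by (simp add: full_subfield)
  thus ?thesis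
    using N.gen_power_dlog[of x] N.chi_gen_power[OF assms, of "N.dlog x"]
      chi_norm_gen_power[OF assms, of "N.dlog x"] by simp
qed

lemma hasse_davenport_norm_trace:
  assumes "z ^ e = 1"
  shows "(\<Sum>x\<in>UNIV. R.\<chi> z (norm_rel p r n x) * R.\<psi> (\<Sum>i<n. x ^ ((p ^ r) ^ i))) =
    (-1) ^ (n - 1) * (\<Sum>x\<in>R.F. R.\<chi> z x * R.\<psi> x) ^ n"
proof -
  define frob :: "'K alg_closure \<Rightarrow> 'K alg_closure" where "frob = (\<lambda>x. x ^ (p ^ r))"
  have funpow_frob: "(frob ^^ i) x = x ^ ((p ^ r) ^ i)" for i x
    unfolding frob_def by (rule funpow_power)
  interpret finite_fixpoints_endomorphism frob
    unfolding frob_def by (rule R.power_map_alg_closure)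
  have Fix: "Fix = to_ac ` R.F"
    unfolding Fix_def using R.alg_closure_power_eq_self by (simp add: frob_def)
  interpret hasse_davenport frob "\<lambda>x. R.\<chi> z (of_ac x)" "\<lambda>x. R.\<psi> (of_ac x)"
  proof
    show "\<exists>c\<in>Fix. R.\<psi> (of_ac c) \<noteq> 1" using R.psi_nontrivial by (auto simp: Fix)
    show "R.\<chi> z (of_ac 1) = 1"
      using R.chi_gen_power[OF assms, of 0] of_ac_to_ac[of "1::'K"] by simp
  qed (auto simp: Fix R.chi_mult[OF assms] R.psi_add R.psi_0 simp flip: to_ac_mult to_ac_add)
  have "p ^ (n * r) = (p ^ r) ^ n" by (simp only: power_mult[symmetric] mult.commute)
  hence fixpoints: "{x. (frob ^^ n) x = x} = range to_ac"
    using N.alg_closure_power_eq_self by (simp add: funpow_frob full_subfield)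
  have "(\<Sum>x\<in>UNIV. R.\<chi> z (norm_rel p r n x) * R.\<psi> (\<Sum>i<n. x ^ ((p ^ r) ^ i))) =
      (\<Sum>x | (frob ^^ n) x = x.
        R.\<chi> z (of_ac (\<Prod>i<n. (frob ^^ i) x)) * R.\<psi> (of_ac (\<Sum>i<n. (frob ^^ i) x)))"
    unfolding fixpoints
    by (simp add: funpow_frob sum.reindex[OF inj_to_ac] norm_rel_def power_mult
        flip: to_ac_power to_ac_sum to_ac_prod)
  also have "\<dots> = (-1) ^ (n - 1) * (\<Sum>x\<in>Fix. R.\<chi> z (of_ac x) * R.\<psi> (of_ac x)) ^ n"
    by (rule hasse_davenport[OF n_pos])
  also have "(\<Sum>x\<in>Fix. R.\<chi> z (of_ac x) * R.\<psi> (of_ac x)) = (\<Sum>x\<in>R.F. R.\<chi> z x * R.\<psi> x)"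
    unfolding Fix by (subst sum.reindex) (auto intro: inj_on_subset[OF inj_to_ac])
  finally show ?thesis .
qed

lemma dft_period_lift:
  assumes "z ^ e = 1"
  shows "dft e N.\<eta> z = (-1) ^ (n - 1) * dft e R.\<eta> z ^ n"
proof -
  have "N.\<psi> x = R.\<psi> (\<Sum>i<n. x ^ ((p ^ r) ^ i))" for x
    by (simp only: N.\<psi>_def R.\<psi>_def R.trace_relative_trace R.zp_char_def N.zp_char_def)
  thus ?thesis
    using hasse_davenport_norm_trace[OF assms]
    by (simp add: N.dft_period_eq_gauss_sum R.dft_period_eq_gauss_sum assms chi_norm full_subfield)
qed

lemma mult_matrix_eq_comp_power: "N.C = (-1) ^ (n - 1) \<cdot>\<^sub>m comp_power e R.C n"
proof -
  have "(map_mat of_int N.C :: complex mat) =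
      (-1) ^ (n - 1) \<cdot>\<^sub>m comp_power e (map_mat of_int R.C) n"
    using R.multiplication_matrix_axioms N.multiplication_matrix_axioms n_pos
      N.dft_period_nonzero dft_period_lift
    by (rule multiplication_matrix_eq_comp_power)
  also have "\<dots> = map_mat of_int ((-1) ^ (n - 1) \<cdot>\<^sub>m comp_power e R.C n)"
    unfolding of_int_hom.mat_hom_comp_power[OF R.mult_matrix_carrier, symmetric]
    by (intro eq_matI) auto
  finally show ?thesis by (simp only: of_int_hom.mat_hom_inj)
qed

end

theorem theorem1p4:
  fixes e p r n :: nat and gam lam :: "'K::{finite,field}"
  assumes "e \<ge> 2" and "prime p" and "r \<ge> 1" and "p ^ r mod e = 1"
    and "n \<ge> 1"
    and "card (UNIV :: 'K set) = p ^ (n * r)"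
    and "is_generator p r gam"
    and "is_generator p (n * r) lam"
    and "\<exists>y \<in> subfield_pm p r - {0}. norm_rel p r n lam * inverse gam = y ^ e"
  shows "mult_matrix p (n * r) e lam = ((-1) ^ (n - 1)) \<cdot>\<^sub>m comp_power e (mult_matrix p r e gam) n
    \<and> period_poly p (n * r) e lam
        = char_poly ((of_int ((-1) ^ (n - 1)) :: complex) \<cdot>\<^sub>m map_mat of_int (comp_power e (mult_matrix p r e gam) n))"
proof -
  have e_dvd: "e dvd p ^ r - 1" using assms(4) by (metis dvd_minus_mod)
  also have "p ^ r - 1 dvd p ^ (n * r) - 1"
    using pred_dvd_power_pred[of "p ^ r" n] prime_gt_0_nat[OF assms(2)]
    by (simp add: mult.commute flip: power_mult)
  finally interpret gaussian_periods_extension p r n e gam lam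
    by unfold_locales (use assms e_dvd in auto)
  have "map_mat of_int N.C =
      (of_int ((-1) ^ (n - 1)) :: complex) \<cdot>\<^sub>m map_mat of_int (comp_power e R.C n)"
    unfolding mult_matrix_eq_comp_power by (rule eq_matI) auto
  thus ?thesis using mult_matrix_eq_comp_power N.char_poly_mult_matrix by simp
qed

end
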